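(* Let $v$ be a power of a prime $p$ and let $h$ be a positive integer. A (circulant) $\mathrm{BH}(\mathbb{Z}_v,h)$ matrix exists if and only if $\nu_p(h)\ge\lceil\nu_p(v)/2\rceil$ and $(v,\nu_2(h))\neq(2,1)$.
   Context: $\nu_q(t)$ is the $q$-adic valuation of $t$. $\mathbb{Z}_v$ is the cyclic group of order $v$. A $\mathrm{BH}(\mathbb{Z}_v,h)$ matrix is a $v\times v$ matrix $H=(H_{g,k})_{g,k\in\mathbb{Z}_v}$ with entries complex $h$th roots of unity, $\mathbb{Z}_v$-invariant ($H_{g+l,k+l}=H_{g,k}$ for all $g,k,l$), with $HH^*=vI$, where $H^*$ is the conjugate transpose. *)

theory Defs
  imports
    Complex_Main
    "HOL-Computational_Algebra.Primes"
    "Jordan_Normal_Form.Schur_Decomposition"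
begin

(* The cyclic group of order v is represented by {0..<v} with addition modulo v, so
   its elements are the row and column indices of a v x v matrix. On complex
   matrices mat_adjoint is the conjugate transpose. The definition is only meant for v > 0. *)

definition cyclic_invariant :: "nat \<Rightarrow> complex mat \<Rightarrow> bool" where
  "cyclic_invariant v H \<longleftrightarrow>
     (\<forall>g<v. \<forall>k<v. \<forall>l<v. H $$ ((g + l) mod v, (k + l) mod v) = H $$ (g, k))"

definition cyclic_BH :: "nat \<Rightarrow> nat \<Rightarrow> complex mat \<Rightarrow> bool" where
  "cyclic_BH v h H \<longleftrightarrow>
     H \<in> carrier_mat v v \<and>
     (\<forall>g<v. \<forall>k<v. (H $$ (g, k)) ^ h = 1) \<and>
     cyclic_invariant v H \<and>
     H * mat_adjoint H = of_nat v \<cdot>\<^sub>m 1\<^sub>m v"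

end

(*
  The first row c of a circulant matrix turns H H* = v I into the statement that all periodic
  autocorrelations of c vanish off 0, equivalently |X_k|^2 = v for the Fourier coefficients
  X_k of c.

  Necessity (v = p^a, h = m p^b, p not dividing m). Let w be a primitive v-th root of unity.
  The primes over p are totally ramified in the p-part of a cyclotomic field, so a Galois
  conjugation z -> z^t with t = 1 modulo the prime-to-p part preserves the ideal of X_k; hence
  X_tk / X_k is an algebraic integer of absolute value 1 at every place, i.e. a root of unity.
  Running over the cyclic group generated by 1 + p^b this gives X_(k + p^b n) = w^(g p^b n) X_k
  with g depending only on k mod p^b. Consequently c differs from its average avg over the
  cosets of the subgroup of order p at no more than phi(p^b) p^b places, whereas elsewhere
  |avg| = 1. Since the sum of |avg|^2 is v/p, this forces a <= 2b. The cases b = 0 and p = 2,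
  b = 1, where the group of units congruent to 1 mod p^b is not generated by 1 + p^b, use that
  more Galois conjugations fix c, so that g does not depend on k at all; the few small a that
  survive are excluded by computing autocorrelations.

  Sufficiency: Milewski's sequences u(x div k) w^((x mod k) (x div k)) of length n k^2 over
  a perfect sequence u of length n in {1, p}.
*)

theory Submission
  imports Defs "HOL-Number_Theory.Number_Theory"
begin

hide_const (open) up_ring.monom up_ring.coeff Module.smult

section \<open>Integer polynomials at roots of unity\<close>

text \<open>No number field is constructed. Z[z] consists of the values \<open>ieval f z\<close>,
  and the conjugation z -> z^t sends such a value to \<open>ieval f (z ^ t)\<close>; irreducibility
  of cyclotomic polynomials makes this well defined. Two obstacles shape the necessity part. The
  primes over p may be non-principal once m > 1, so ideals are compared only modulo powers of
  \<open>1 - z ^ m\<close>. And Kronecker's theorem does not bound the order of the root of unity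
  X_tk / X_k, so the order N of z stays variable and this quotient is examined again in a larger
  ring. It then splits as e w^j with e of order prime to p; following the orbit until it closes
  after p^(a-b) steps forces e = 1 and p^b | j, which is the form of the phase g. Origin of the
  counting bound: the frequencies in one class mod p^b form a geometric progression, whose inverse
  transform vanishes off one residue class mod p^(a-b), that is, off p^b places. Comparing energies
  gives (p-1) p^(a-1) <= phi(p^b) p^b = (p-1) p^(2b-1). With a g common to all classes the right
  side drops to p^b, which is why so few a survive in the exceptional cases.\<close>

definition ieval :: "int poly \<Rightarrow> complex \<Rightarrow> complex" where
  "ieval f z = poly (map_poly of_int f) z"

lemma ieval_simps [simp]:
  "ieval 0 z = 0" "ieval 1 z = 1" "ieval (f + g) z = ieval f z + ieval g z"
  "ieval (f - g) z = ieval f z - ieval g z" "ieval (- f) z = - ieval f z"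
  "ieval (f * g) z = ieval f z * ieval g z" "ieval (f ^ n) z = ieval f z ^ n"
  "ieval (smult c f) z = of_int c * ieval f z" "ieval [:c:] z = of_int c"
  "ieval (monom c n) z = of_int c * z ^ n" "ieval (pCons c f) z = of_int c + z * ieval f z"
  by (simp_all add: ieval_def hom_distribs poly_monom map_poly_pCons )

lemma ieval_sum: "ieval (\<Sum>i\<in>A. f i) z = (\<Sum>i\<in>A. ieval (f i) z)"
  by (induction A rule: infinite_finite_induct) auto

lemma ieval_prod: "ieval (\<Prod>i\<in>A. f i) z = (\<Prod>i\<in>A. ieval (f i) z)"
  by (induction A rule: infinite_finite_induct) auto

lemma ieval_pcompose [simp]: "ieval (f \<circ>\<^sub>p g) z = ieval f (ieval g z)"
  by (induction f) (auto simp: pcompose_pCons)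

lemma ieval_altdef: "ieval f z = (\<Sum>i\<le>degree f. of_int (coeff f i) * z ^ i)"
  by (simp add: ieval_def poly_altdef)

section \<open>Frobenius congruences\<close>

lemma prime_dvd_binomial_sum:
  fixes a b :: "'a :: comm_ring_1"
  assumes "prime p"
  shows "of_nat p dvd (a + b) ^ p - a ^ p - b ^ p"
proof -
  have p: "p > 1" using assms prime_gt_1_nat by blast
  have "(a + b) ^ p = (\<Sum>k\<le>p. of_nat (p choose k) * a ^ k * b ^ (p - k))"
    by (rule binomial_ring)
  also have "{..p} = insert 0 (insert p {1..<p})" using p by auto
  also have "(\<Sum>k\<in>\<dots>. of_nat (p choose k) * a ^ k * b ^ (p - k)) =
     b ^ p + a ^ p + (\<Sum>k\<in>{1..<p}. of_nat (p choose k) * a ^ k * b ^ (p - k))"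
    using p by simp
  finally have *: "(a + b) ^ p - a ^ p - b ^ p = (\<Sum>k\<in>{1..<p}. of_nat (p choose k) * a ^ k * b ^ (p - k))"
    by simp
  show ?thesis unfolding *
  proof (rule dvd_sum)
    fix k assume "k \<in> {1..<p}"
    hence "p dvd (p choose k)" using assms by (intro dvd_choose_prime) auto
    then obtain c where "p choose k = p * c" by blast
    thus "of_nat p dvd of_nat (p choose k) * a ^ k * b ^ (p - k)"
      by (simp add: mult.assoc)
  qed
qed

text \<open>Induction over \<open>pCons\<close>: the binomial theorem modulo \<open>p\<close> splits
  off the constant term, and Fermat's little theorem handles that term.\<close>

lemma frobenius_poly:
  fixes f :: "int poly"
  assumes "prime p"
  shows "of_nat p dvd f ^ p - f \<circ>\<^sub>p monom 1 p"
proof (induction f)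
  case (pCons a f)
  have dec: "pCons a f = [:a:] + monom 1 1 * f"
    by (simp add: monom_Suc)
  have 1: "of_nat p dvd ([:a:] + monom 1 1 * f) ^ p - [:a:] ^ p - (monom 1 1 * f) ^ p"
    by (rule prime_dvd_binomial_sum[OF assms])
  have "[a ^ p = a] (mod int p)"
  proof (cases "int p dvd a")
    case True
    hence "int p dvd a ^ p" using assms prime_gt_0_nat by (metis dvd_power dvd_trans)
    thus ?thesis using True by (simp add: cong_def mod_eq_0_iff_dvd)
  next
    case False
    define n where "n = nat (a mod int p)"
    have n: "int n = a mod int p" using assms by (simp add: n_def prime_gt_0_nat)
    have "\<not> p dvd n" using False n by (metis dvd_mod_iff dvd_refl int_dvd_int_iff)
    hence "[n ^ (p - 1) = 1] (mod p)" using assms fermat_theorem by blast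
    hence "[int n ^ (p - 1) = 1] (mod int p)" by (metis cong_int_iff of_nat_1 of_nat_power)
    hence "[a ^ (p - 1) = 1] (mod int p)" unfolding n by (simp add: cong_def power_mod)
    hence "[a ^ (p - 1) * a = 1 * a] (mod int p)" by (intro cong_mult) auto
    thus ?thesis using power_minus_mult[of p a] assms by (simp add: prime_gt_0_nat)
  qed
  hence "int p dvd a ^ p - a" by (simp add: cong_iff_dvd_diff)
  then obtain c where c: "a ^ p - a = int p * c" by blast
  have 2: "of_nat p dvd [:a:] ^ p - [:a:]"
  proof
    show "[:a:] ^ p - [:a:] = of_nat p * [:c:]"
      using c by (simp add: poly_const_pow of_nat_poly)
  qed
  have 3: "of_nat p dvd monom 1 p * (f ^ p - f \<circ>\<^sub>p monom 1 p)"
    using pCons.IH by simp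
  have "pCons a f ^ p - pCons a f \<circ>\<^sub>p monom 1 p =
     (([:a:] + monom 1 1 * f) ^ p - [:a:] ^ p - (monom 1 1 * f) ^ p) + ([:a:] ^ p - [:a:])
     + monom 1 p * (f ^ p - f \<circ>\<^sub>p monom 1 p)"
    unfolding pcompose_pCons by (subst dec) (simp add: power_mult_distrib monom_power algebra_simps)
  thus ?case using dvd_add[OF dvd_add[OF 1 2] 3] by (simp only:)
qed (use assms prime_gt_0_nat in \<open>auto simp: power_0_left\<close>)

section \<open>Primitive roots of unity\<close>

definition proot :: "nat \<Rightarrow> complex \<Rightarrow> bool" where
  "proot N z \<longleftrightarrow> N > 0 \<and> (\<forall>k. z ^ k = 1 \<longleftrightarrow> N dvd k)"

lemma proot_power_eq_1_iff: "proot N z \<Longrightarrow> z ^ k = 1 \<longleftrightarrow> N dvd k"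
  and proot_pos: "proot N z \<Longrightarrow> N > 0"
  by (auto simp: proot_def)

lemma proot_nonzero: "proot N z \<Longrightarrow> z \<noteq> 0"
  by (metis dvd_refl power_0_left proot_def zero_neq_one not_gr0)

lemma proot_cis: "N > 0 \<Longrightarrow> proot N (cis (2 * pi / N))"
proof -
  assume N: "N > 0"
  have "cis (2 * pi / N) ^ k = 1 \<longleftrightarrow> N dvd k" for k
  proof -
    have "cis (2 * pi / N) ^ k = cis (real k * (2 * pi / N))" by (rule DeMoivre)
    also have "\<dots> = 1 \<longleftrightarrow> (\<exists>x::int. real k * (2 * pi / N) = real_of_int x * 2 * pi)"
      by (auto simp: complex_eq_iff cos_one_2pi_int sin_eq_0_pi) (metis sin_int_2pin mult.commute mult.assoc)
    also have "\<dots> \<longleftrightarrow> (\<exists>x::int. int k = x * int N)"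
    proof -
      have "real k * (2 * pi / N) = real_of_int x * 2 * pi \<longleftrightarrow> int k = x * int N" for x
      proof -
        have "real k * (2 * pi / N) = real_of_int x * 2 * pi \<longleftrightarrow> real k = real_of_int x * real N"
          using N by (simp add: field_simps)
        also have "\<dots> \<longleftrightarrow> real_of_int (int k) = real_of_int (x * int N)" by simp
        finally show ?thesis by (simp only: of_int_eq_iff)
      qed
      thus ?thesis by simp
    qed
    also have "\<dots> \<longleftrightarrow> int N dvd int k" by (auto simp: dvd_def mult.commute)
    finally show ?thesis by simp
  qed
  thus ?thesis using N by (simp add: proot_def)
qed

lemma proot_power_coprime:
  assumes "proot N z" "coprime t N"
  shows "proot N (z ^ t)"
  using assms unfolding proot_def
  by (auto simp flip: power_mult simp: coprime_commute coprime_dvd_mult_right_iff)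

lemma proot_power_div:
  assumes "proot (m * n) z"
  shows "proot n (z ^ m)"
  using assms unfolding proot_def by (auto simp flip: power_mult)

lemma proot_power_eq_iff:
  assumes "proot N z"
  shows "z ^ i = z ^ j \<longleftrightarrow> [i = j] (mod N)"
proof -
  have *: "z ^ i = z ^ j \<longleftrightarrow> [i = j] (mod N)" if "i \<le> j" for i j
  proof -
    have "z ^ j = z ^ i * z ^ (j - i)" using that by (simp flip: power_add)
    hence "z ^ i = z ^ j \<longleftrightarrow> z ^ (j - i) = 1" using proot_nonzero[OF assms] by auto
    also have "\<dots> \<longleftrightarrow> N dvd (j - i)" using assms by (simp add: proot_def)
    also have "\<dots> \<longleftrightarrow> [i = j] (mod N)" using that by (metis cong_sym_eq cong_altdef_nat)
    finally show ?thesis .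
  qed
  show ?thesis using *[of i j] *[of j i] by (metis cong_sym_eq nle_le)
qed

lemma proot_norm: assumes "proot N z" shows "cmod z = 1"
proof -
  have "z ^ N = 1" "N > 0" using assms by (auto simp: proot_def)
  thus ?thesis by (metis norm_one norm_power power_eq_1_iff norm_ge_zero gr_implies_not0)
qed

lemma cnj_power_root_of_unity:
  assumes "z ^ N = 1" "N > 0"
  shows "cnj z = z ^ (N - 1)"
proof -
  have n: "cmod z = 1" using assms by (metis norm_one norm_power power_eq_1_iff norm_ge_zero gr_implies_not0)
  have "z * cnj z = 1" using n by (simp add: complex_norm_square [symmetric])
  moreover have "z * z ^ (N - 1) = 1" using assms by (simp add: power_eq_if)
  ultimately show ?thesis by (metis mult_cancel_left mult_zero_left zero_neq_one)
qed

section \<open>Minimal polynomials and Galois conjugates\<close>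

lemma ieval_cnj: "cnj (ieval f z) = ieval f (cnj z)"
  by (induction f) auto

text \<open>Gauss's lemma: an annihilator of least degree divides all others over the rationals, and
  its primitive part does so over the integers.\<close>

lemma ieval_minimal_poly:
  assumes "ieval f0 z = 0" "f0 \<noteq> 0"
  obtains m where "m \<noteq> 0" "ieval m z = 0" "\<And>f. ieval f z = 0 \<Longrightarrow> m dvd f"
    "\<And>f. ieval f z = 0 \<Longrightarrow> degree f < degree m \<Longrightarrow> f = 0" "degree m > 0"
proof -
  define P where "P g \<longleftrightarrow> g \<noteq> 0 \<and> ieval g z = 0" for g
  define g where "g = arg_min degree P"
  have "P f0" using assms by (simp add: P_def)
  hence g: "P g" unfolding g_def by (rule arg_min_natI)
  have g_min: "degree g \<le> degree f" if "P f" for f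
    unfolding g_def using that by (rule arg_min_nat_le)
  define m where "m = primitive_part g"
  have gm: "g = smult (content g) m" by (simp add: m_def)
  have "content g \<noteq> 0" using g by (simp add: P_def)
  have m0: "m \<noteq> 0" using g by (auto simp: P_def m_def)
  have dm: "degree m = degree g" using gm \<open>content g \<noteq> 0\<close> by (metis degree_smult_eq)
  have mz: "ieval m z = 0" using g gm \<open>content g \<noteq> 0\<close> unfolding P_def
    by (metis ieval_simps(8) mult_eq_0_iff of_int_eq_0_iff)
  have cm: "content m = 1" using g by (simp add: P_def m_def)
  have small: "f = 0" if "ieval f z = 0" "degree f < degree m" for f
    using g_min[of f] that dm by (force simp: P_def)
  have "m dvd f" if f: "ieval f z = 0" for f
  proof -
    from pseudo_mod(1)[OF m0, of f] obtain a q where aq: "a \<noteq> 0" "smult a f = m * q + pseudo_mod f m"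
      by blast
    have "ieval (smult a f) z = ieval (m * q + pseudo_mod f m) z" by (simp only: aq)
    hence "ieval (pseudo_mod f m) z = 0" using f mz by simp
    hence "pseudo_mod f m = 0" using pseudo_mod(2)[OF m0, of f] small by blast
    hence e: "smult a f = m * q" using aq by simp
    \<comment> \<open>As \<open>m\<close> is primitive, the factor \<open>a\<close> introduced by
      pseudo-division divides the content of \<open>q\<close> and can be cancelled.\<close>
    have "content q = content (m * q)" by (simp add: content_mult cm)
    also have "\<dots> = normalize a * content f" by (simp flip: e)
    finally have "a dvd content q" by simp
    then obtain q' where "q = [:a:] * q'"
      using const_poly_dvd_iff_dvd_content by (metis dvdE)
    hence "smult a f = smult a (m * q')" using e by simp
    hence "f = m * q'" using \<open>a \<noteq> 0\<close> by (metis smult_cancel)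
    thus ?thesis by simp
  qed
  moreover have "degree m > 0"
  proof (rule ccontr)
    assume "\<not> degree m > 0"
    then obtain c where "m = [:c:]" by (metis degree_eq_zeroE gr0I)
    thus False using m0 mz by simp
  qed
  ultimately show ?thesis using that m0 mz small by blast
qed

text \<open>Dedekind's argument for the irreducibility of cyclotomic polynomials: with
  \<open>m\<close> the minimal polynomial of \<open>z\<close>, the Frobenius congruence makes
  \<open>ieval m (z ^ l)\<close> equal to \<open>l\<close> times an element of Z[z].\<close>

lemma ieval_power_prime_eq_0:
  assumes z: "proot N z" and l: "prime l" "\<not> l dvd N" and f: "ieval f z = 0"
  shows "ieval f (z ^ l) = 0"
proof -
  have N: "N > 0" using z proot_pos by blast
  define w where "w = z ^ l"
  have zN: "z ^ N = 1" using z by (simp add: proot_def)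
  have wN: "w ^ N = 1" unfolding w_def using zN by (metis power_commutes power_mult power_one mult.commute)
  define X where "X = monom 1 N - (1 :: int poly)"
  have X: "ieval X z = 0" "ieval X w = 0" using zN wN by (simp_all add: X_def)
  have cX: "coeff X N = 1" "degree X = N"
  proof -
    show 1: "coeff X N = 1" using N by (simp add: X_def)
    have "degree X \<le> N" unfolding X_def by (intro degree_diff_le degree_monom_le) auto
    thus "degree X = N" using 1 by (metis le_antisym le_degree zero_neq_one)
  qed
  have "X \<noteq> 0" using cX by auto
  obtain m where m: "m \<noteq> 0" "ieval m z = 0" "\<And>f. ieval f z = 0 \<Longrightarrow> m dvd f"
    "\<And>f. ieval f z = 0 \<Longrightarrow> degree f < degree m \<Longrightarrow> f = 0" "degree m > 0"
    using ieval_minimal_poly[OF X(1) \<open>X \<noteq> 0\<close>] by blast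
  obtain g where g: "X = m * g" using m(3)[OF X(1)] by blast
  have "lead_coeff m * lead_coeff g = 1" using cX unfolding g by (metis lead_coeff_mult)
  hence lcm: "lead_coeff m dvd 1" by (metis dvd_triv_left)
  \<comment> \<open>Otherwise differentiating \<open>X = m * g\<close> at \<open>w\<close> shows that \<open>N\<close> is divisible by \<open>l\<close>.\<close>
  have "ieval m w = 0"
  proof (rule ccontr)
    assume nz: "ieval m w \<noteq> 0"
    hence gw: "ieval g w = 0" using X(2) unfolding g by simp
    have "pderiv X = monom (int N) (N - 1)"
      by (simp add: X_def pderiv_diff pderiv_monom)
    hence "ieval (monom (int N) (N - 1)) w = ieval (pderiv (m * g)) w" by (simp add: g)
    hence 1: "of_nat N * w ^ (N - 1) = ieval m w * ieval (pderiv g) w"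
      using gw by (simp add: pderiv_mult)
    have "of_nat l dvd m ^ l - m \<circ>\<^sub>p monom 1 l" using l by (intro frobenius_poly)
    then obtain k where k: "m ^ l - m \<circ>\<^sub>p monom 1 l = of_nat l * k" by blast
    have "ieval (m ^ l - m \<circ>\<^sub>p monom 1 l) z = - ieval m w"
      using m(2) l by (simp add: w_def prime_gt_0_nat)
    hence 2: "ieval m w = - (of_nat l * ieval k z)" unfolding k by (simp add: of_nat_poly)
    define K where "K = monom 1 l * k * (pderiv g \<circ>\<^sub>p monom 1 l)"
    have "of_nat N = of_nat N * w ^ (N - 1) * w" using wN N by (simp add: mult.assoc flip: power_Suc2)
    also have "\<dots> = - of_nat l * ieval K z" unfolding 1 2 K_def by (simp add: w_def)
    finally have NK: "of_nat N = - of_nat l * ieval K z" .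
    \<comment> \<open>\<open>NK\<close> places \<open>N\<close> in l Z[z]. To return to integers,
      reduce \<open>K\<close> modulo \<open>m\<close>, whose leading coefficient is a unit because
      \<open>m\<close> divides the monic \<open>X\<close>. The remainder has degree below that of
      \<open>m\<close>, so the relation holds between polynomials and constant terms may be
      compared.\<close>
    obtain q r where qr: "pseudo_divmod K m = (q, r)" by (cases "pseudo_divmod K m")
    define c where "c = lead_coeff m ^ (Suc (degree K) - degree m)"
    have "c dvd 1" unfolding c_def using lcm by (simp add: power_abs)
    have div: "smult c K = m * q + r" "r = 0 \<or> degree r < degree m"
      using pseudo_divmod[OF m(1) qr] by (simp_all add: c_def)
    have "ieval (smult c K) z = ieval (m * q + r) z" by (simp only: div)
    hence r: "ieval r z = of_int c * ieval K z" using m(2) by simp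
    define Q where "Q = [:c * int N:] + smult (int l) r"
    have "ieval Q z = of_int c * (of_nat N + of_nat l * ieval K z)"
      by (simp add: Q_def r algebra_simps)
    hence "ieval Q z = 0" using NK by simp
    moreover have "degree Q < degree m"
      unfolding Q_def using div(2) m(5) by (intro degree_add_less) (auto intro: le_less_trans[OF degree_smult_le])
    ultimately have "Q = 0" using m(4) by blast
    hence "coeff Q 0 = 0" by simp
    hence "c * int N = int l * (- coeff r 0)" by (simp add: Q_def)
    hence "int l dvd c * int N" by simp
    hence "int l dvd int N" using \<open>c dvd 1\<close> by (metis dvd_mult_unit_iff' is_unit_mult_iff)
    thus False using l by simp
  qed
  moreover have "m dvd f" using m(3) f by blast
  ultimately show ?thesis by (auto simp: w_def elim!: dvdE)
qed

text \<open>This makes \<open>ieval f z\<close> -> \<open>ieval f (z ^ t)\<close> well defined on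
  Z[z]; every later use of Galois theory is an instance. The prime factors of \<open>t\<close> are
  handled one at a time, each step leading to another primitive root.\<close>

lemma ieval_power_coprime_eq_0:
  assumes "proot N z" "coprime t N" "ieval f z = 0"
  shows "ieval f (z ^ t) = 0"
  using assms
proof (induction t arbitrary: z rule: less_induct)
  case (less t)
  consider "t = 0" | "t = 1" | "t > 1" by linarith
  thus ?case
  proof cases
    case 1
    hence "N = 1" using less.prems by simp
    hence "z ^ 1 = 1" using proot_power_eq_1_iff[OF less.prems(1), of 1] by simp
    thus ?thesis using 1 less.prems by simp
  next
    case 3
    then obtain l where l: "prime l" "l dvd t" using prime_factor_nat[of t] by auto
    then obtain s where t: "t = l * s" by blast
    have cop: "coprime l N" "coprime s N" using less.prems(2) unfolding t by auto
    have "\<not> l dvd N" using cop l by (metis coprime_absorb_left not_prime_unit)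
    hence "ieval f (z ^ l) = 0" using ieval_power_prime_eq_0 less.prems l by blast
    moreover have "s < t" using l 3 t prime_gt_1_nat[of l] by (cases "s = 0") auto
    moreover have "proot N (z ^ l)" using less.prems cop proot_power_coprime by blast
    ultimately have "ieval f ((z ^ l) ^ s) = 0" using less.IH cop by blast
    thus ?thesis by (simp add: t power_mult)
  qed (use less.prems in auto)
qed

section \<open>Character sums and Kronecker's theorem\<close>

lemma sum_powers_root_of_unity:
  fixes x :: complex
  assumes "x ^ N = 1"
  shows "(\<Sum>t<N. x ^ t) = (if x = 1 then of_nat N else 0)"
  using assms by (simp add: sum_gp_strict)

lemma sum_proot_quotient_powers:
  assumes "proot N z"
  shows "(\<Sum>t<N. (z ^ i * cnj z ^ j) ^ t) = (if [i = j] (mod N) then of_nat N else 0)"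
proof -
  have zz: "cnj z * z = 1"
    using proot_norm[OF assms] by (simp add: mult.commute[of "cnj z"] flip: complex_norm_square)
  hence zz': "z * cnj z = 1" by (simp add: mult.commute)
  have 1: "z ^ i * cnj z ^ j = 1 \<longleftrightarrow> z ^ i = z ^ j"
  proof
    assume "z ^ i * cnj z ^ j = 1"
    hence "z ^ i * (cnj z * z) ^ j = z ^ j" by (simp add: power_mult_distrib mult_ac)
    thus "z ^ i = z ^ j" by (simp add: zz)
  qed (simp add: zz' flip: power_mult_distrib)
  have z1: "z ^ N = 1" using assms by (simp add: proot_def)
  have "(z ^ i * cnj z ^ j) ^ N = (z ^ N) ^ i * cnj ((z ^ N) ^ j)"
    by (simp add: power_mult_distrib mult.commute flip: power_mult)
  hence "(z ^ i * cnj z ^ j) ^ N = 1" unfolding z1 by simp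
  thus ?thesis by (simp add: sum_powers_root_of_unity 1 proot_power_eq_iff[OF assms])
qed

text \<open>A substitute for the trace: summing over all \<open>N\<close>-th roots of unity, not
  only the primitive ones, reduces integrality to power sums, each of which is \<open>N\<close> or
  0.\<close>

lemma sum_ieval_Ints:
  assumes "z ^ N = 1"
  shows "(\<Sum>t<N. ieval f (z ^ t)) \<in> \<int>"
proof -
  have "(\<Sum>t<N. ieval f (z ^ t)) = (\<Sum>i\<le>degree f. of_int (coeff f i) * (\<Sum>t<N. (z ^ i) ^ t))"
    unfolding ieval_altdef by (subst sum.swap) (simp add: sum_distrib_left mult.commute flip: power_mult)
  also have "(z ^ i) ^ N = 1" for i using assms by (metis power_commutes power_mult power_one mult.commute)
  hence "(\<Sum>t<N. (z ^ i) ^ t) \<in> \<int>" for i by (subst sum_powers_root_of_unity) auto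
  hence "(\<Sum>i\<le>degree f. of_int (coeff f i) * (\<Sum>t<N. (z ^ i) ^ t)) \<in> \<int>" by auto
  finally show ?thesis .
qed

text \<open>
  The factor \<open>e\<close> below vanishes at all non-primitive \<open>N\<close>-th roots of unity. Thus the integers
  \<open>T k i\<close>, which determine the \<open>k\<close>-th power, only involve the conjugates of \<open>g\<close> and are bounded
  independently of \<open>k\<close>.
\<close>
lemma kronecker_root_of_unity:
  assumes z: "proot N z" and g: "\<And>s. coprime s N \<Longrightarrow> cmod (ieval g (z ^ s)) = 1"
  shows "\<exists>M>0. ieval g z ^ M = 1"
proof -
  have N: "N > 0" and zN: "z ^ N = 1" using z by (auto simp: proot_def)
  define D where "D = {d. d dvd N \<and> d < N}"
  have "finite D" by (simp add: D_def)
  define e where "e = (\<Prod>d\<in>D. monom 1 d - (1 :: int poly))"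
  have e_eq: "ieval e y = (\<Prod>d\<in>D. y ^ d - 1)" for y by (simp add: e_def ieval_prod)
  have e0: "ieval e (z ^ t) = 0" if "\<not> coprime t N" for t
  proof -
    define G where "G = gcd t N"
    have "G \<noteq> 1" unfolding G_def using that coprime_iff_gcd_eq_1 by blast
    have "G > 0" using N by (simp add: G_def)
    obtain d where d: "N = G * d" using gcd_dvd2 unfolding G_def by blast
    obtain t' where t': "t = G * t'" using gcd_dvd1 unfolding G_def by blast
    have "G > 1" using \<open>G \<noteq> 1\<close> \<open>G > 0\<close> by linarith
    hence "d \<in> D" using N d by (simp add: D_def)
    moreover have "N dvd t * d" by (simp add: d t')
    hence "(z ^ t) ^ d = 1" using proot_power_eq_1_iff[OF z] by (simp flip: power_mult)
    ultimately show ?thesis using \<open>finite D\<close> by (auto simp: e_eq)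
  qed
  have e1: "ieval e z \<noteq> 0"
  proof -
    have "z ^ d \<noteq> 1" if "d \<in> D" for d
      using that z N unfolding D_def proot_def by (auto dest: dvd_imp_le)
    thus ?thesis using \<open>finite D\<close> by (simp add: e_eq)
  qed
  define T where "T k i = (\<Sum>t<N. ieval (g ^ k * e * monom 1 i) (z ^ t))" for k i
  define B where "B = (\<Sum>t<N. cmod (ieval e (z ^ t)))"
  define I where "I = (of_int :: int \<Rightarrow> complex) ` {-\<lceil>B\<rceil>..\<lceil>B\<rceil>}"
  have zt: "cmod (z ^ t) = 1" for t using proot_norm[OF z] by (simp add: norm_power)
  have T: "T k i \<in> I" for k i
  proof -
    have "T k i \<in> \<int>" unfolding T_def by (rule sum_ieval_Ints[OF zN])
    then obtain n where n: "T k i = of_int n" by (auto elim: Ints_cases)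
    have "cmod (T k i) \<le> (\<Sum>t<N. cmod (ieval (g ^ k * e * monom 1 i) (z ^ t)))"
      unfolding T_def by (rule norm_sum)
    also have "\<dots> \<le> B" unfolding B_def
    proof (rule sum_mono)
      fix t
      show "cmod (ieval (g ^ k * e * monom 1 i) (z ^ t)) \<le> cmod (ieval e (z ^ t))"
        using g[of t] e0[of t] by (cases "coprime t N") (auto simp: norm_mult norm_power zt proot_norm[OF z])
    qed
    finally have "\<bar>real_of_int n\<bar> \<le> B" by (simp add: n)
    hence "n \<in> {-\<lceil>B\<rceil>..\<lceil>B\<rceil>}" by (auto simp: le_ceiling_iff ceiling_le_iff) linarith+
    thus ?thesis using n by (auto simp: I_def)
  qed
  \<comment> \<open>Pigeonhole: every \<open>F k\<close> is one of finitely many integer vectors, so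
    two exponents share the same vector.\<close>
  define F where "F k = restrict (T k) {..<N}" for k
  have "range F \<subseteq> PiE {..<N} (\<lambda>_. I)" using T by (auto simp: F_def restrict_def PiE_iff extensional_def split: if_splits)
  moreover have "finite (PiE {..<N} (\<lambda>_. I))" by (intro finite_PiE) (auto simp: I_def)
  ultimately have "finite (range F)" by (rule finite_subset)
  hence "\<not> inj F" using finite_imageD infinite_UNIV_nat by blast
  then obtain k k' where kk: "k < k'" "F k = F k'"
    unfolding inj_def by (metis nat_neq_iff)
  \<comment> \<open>Inverse Fourier transform of \<open>T k\<close>, which isolates the conjugate at
    \<open>z\<close> itself.\<close>
  have inv: "(\<Sum>i<N. cnj z ^ i * F k i) = of_nat N * (ieval g z ^ k * ieval e z)" for k
  proof -
    have "(\<Sum>i<N. cnj z ^ i * F k i) = (\<Sum>i<N. cnj z ^ i * T k i)" by (simp add: F_def)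
    also have "\<dots> = (\<Sum>t<N. ieval (g ^ k * e) (z ^ t) * (\<Sum>i<N. (cnj z * z ^ t) ^ i))"
      unfolding T_def sum_distrib_left
      by (subst sum.swap) (simp add: power_mult_distrib mult_ac)
    \<comment> \<open>\<open>1 mod N\<close> instead of 1, because for \<open>N = 1\<close> the only
      index is 0.\<close>
    also have "\<dots> = (\<Sum>t<N. if t = 1 mod N then of_nat N * ieval (g ^ k * e) (z ^ t) else 0)"
    proof (rule sum.cong)
      fix t assume t: "t \<in> {..<N}"
      have 1: "cnj z * z = 1" using proot_norm[OF z] by (simp add: mult.commute[of "cnj z"] flip: complex_norm_square)
      have "cnj z * z ^ t = 1 \<longleftrightarrow> z ^ t = z ^ 1"
        using 1 proot_nonzero[OF z] by (metis mult.left_commute mult.right_neutral mult.commute power_one_right)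
      also have "\<dots> \<longleftrightarrow> t = 1 mod N" using t proot_power_eq_iff[OF z, of t 1] by (auto simp: cong_def)
      finally have 2: "cnj z * z ^ t = 1 \<longleftrightarrow> t = 1 mod N" .
      have "(cnj z * z ^ t) ^ N = cnj (z ^ N) * (z ^ N) ^ t"
        by (simp add: power_mult_distrib mult.commute flip: power_mult)
      hence "(cnj z * z ^ t) ^ N = 1" using zN by simp
      thus "ieval (g ^ k * e) (z ^ t) * (\<Sum>i<N. (cnj z * z ^ t) ^ i) =
         (if t = 1 mod N then of_nat N * ieval (g ^ k * e) (z ^ t) else 0)"
        by (simp add: sum_powers_root_of_unity 2)
    qed auto
    also have "\<dots> = of_nat N * ieval (g ^ k * e) (z ^ (1 mod N))"
      using N by simp
    also have "z ^ (1 mod N) = z" using proot_power_eq_iff[OF z, of "1 mod N" 1] by (simp add: cong_def)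
    finally show ?thesis by simp
  qed
  have "of_nat N * (ieval g z ^ k * ieval e z) = of_nat N * (ieval g z ^ k' * ieval e z)"
    using inv[of k] inv[of k'] kk(2) by metis
  hence eq: "ieval g z ^ k = ieval g z ^ k'" using e1 N by simp
  have "cmod (ieval g z) = 1" using g[of 1] by simp
  hence nz: "ieval g z \<noteq> 0" by auto
  have "ieval g z ^ k' = ieval g z ^ k * ieval g z ^ (k' - k)" using kk by (simp flip: power_add)
  hence "ieval g z ^ (k' - k) = 1" using eq nz by simp
  thus ?thesis using kk by (intro exI[of _ "k' - k"]) auto
qed

section \<open>Galois conjugates over a totally ramified prime\<close>

text \<open>For \<open>r\<close> in Z[z] this is congruence modulo the principal ideal of
  \<open>r\<close>. The sides are arbitrary complex numbers, so no membership in Z[z] has to be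
  carried along.\<close>

definition zcong :: "complex \<Rightarrow> complex \<Rightarrow> complex \<Rightarrow> complex \<Rightarrow> bool" where
  "zcong z r x y \<longleftrightarrow> (\<exists>f. x - y = r * ieval f z)"

lemma zcong_refl [simp]: "zcong z r x x"
  unfolding zcong_def by (intro exI[of _ 0]) auto

lemma zcong_sym: "zcong z r x y \<Longrightarrow> zcong z r y x"
  unfolding zcong_def by (metis ieval_simps(5) minus_diff_eq mult_minus_right)

lemma zcong_trans [trans]: "zcong z r x y \<Longrightarrow> zcong z r y w \<Longrightarrow> zcong z r x w"
  unfolding zcong_def by (metis diff_add_cancel add_diff_eq ieval_simps(3) ring_class.ring_distribs(1))

lemma zcong_add: "zcong z r x y \<Longrightarrow> zcong z r x' y' \<Longrightarrow> zcong z r (x + x') (y + y')"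
  unfolding zcong_def by (metis add_diff_add ieval_simps(3) ring_class.ring_distribs(1))

lemma zcong_mult: "zcong z r x y \<Longrightarrow> zcong z r (ieval f z * x) (ieval f z * y)"
  unfolding zcong_def by (metis ieval_simps(6) mult.left_commute right_diff_distrib')

lemma zcong_sum:
  "(\<And>i. i \<in> A \<Longrightarrow> zcong z r (f i) (g i)) \<Longrightarrow> zcong z r (\<Sum>i\<in>A. f i) (\<Sum>i\<in>A. g i)"
  by (induction A rule: infinite_finite_induct) (auto intro: zcong_add)

lemma zcong_power:
  assumes "zcong z r (ieval f z) (ieval g z)"
  shows "zcong z r (ieval f z ^ n) (ieval g z ^ n)"
proof (induction n)
  case (Suc n)
  have "zcong z r (ieval f z * ieval f z ^ n) (ieval f z * ieval g z ^ n)"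
    by (rule zcong_mult[OF Suc.IH])
  also have "zcong z r (ieval (g ^ n) z * ieval f z) (ieval (g ^ n) z * ieval g z)"
    by (rule zcong_mult[OF assms])
  hence "zcong z r (ieval f z * ieval g z ^ n) (ieval g z * ieval g z ^ n)"
    by (simp add: mult.commute)
  finally show ?case by simp
qed auto

lemma zcong_ieval_power: "zcong z (z ^ i - z) (ieval f (z ^ i)) (ieval f z)"
proof (induction f)
  case (pCons a f)
  then obtain g where g: "ieval f (z ^ i) - ieval f z = (z ^ i - z) * ieval g z"
    by (auto simp: zcong_def)
  have "ieval (pCons a f) (z ^ i) - ieval (pCons a f) z =
     z ^ i * (ieval f (z ^ i) - ieval f z) + (z ^ i - z) * ieval f z"
    by (simp add: algebra_simps)
  also have "\<dots> = (z ^ i - z) * ieval (monom 1 i * g + f) z"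
    by (simp add: g algebra_simps)
  finally show ?case unfolding zcong_def by blast
qed auto

lemma zcong_weaken: "zcong z (r * ieval f z) x y \<Longrightarrow> zcong z r x y"
  unfolding zcong_def by (metis ieval_simps(6) mult.assoc)

lemma monom_pcompose_monom: "monom (1 :: int) i \<circ>\<^sub>p monom 1 j = monom 1 (i * j)"
proof -
  have "monom (1 :: int) i \<circ>\<^sub>p monom 1 j = (monom 1 j) ^ i"
    by (induction i) (auto simp: monom_Suc pcompose_pCons monom_0 pcompose_1 simp flip: one_pCons)
  thus ?thesis by (simp add: monom_power mult.commute)
qed

lemma frobenius_poly_power:
  fixes f :: "int poly"
  assumes "prime p"
  shows "of_nat p dvd f ^ (p ^ s) - f \<circ>\<^sub>p monom 1 (p ^ s)"
proof (induction s)
  case 0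
  have "f \<circ>\<^sub>p monom 1 1 = f" by (simp add: monom_altdef)
  thus ?case by simp
next
  case (Suc s)
  define F where "F = f ^ (p ^ s)"
  define G where "G = f \<circ>\<^sub>p monom 1 (p ^ s)"
  have "F - G dvd F ^ p - G ^ p" by (subst power_diff_sumr2) simp
  hence 1: "of_nat p dvd F ^ p - G ^ p" using Suc.IH unfolding F_def G_def by (rule dvd_trans[rotated])
  have 2: "of_nat p dvd G ^ p - G \<circ>\<^sub>p monom 1 p" by (rule frobenius_poly[OF assms])
  have 3: "G \<circ>\<^sub>p monom 1 p = f \<circ>\<^sub>p monom 1 (p ^ Suc s)"
    by (simp add: G_def monom_pcompose_monom mult.commute flip: pcompose_assoc)
  have 4: "F ^ p = f ^ (p ^ Suc s)" by (simp add: F_def mult.commute flip: power_mult)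
  show ?case using dvd_add[OF 1 2] by (simp add: 3 4)
qed

section \<open>Ideals over p in a cyclotomic ring\<close>

locale prime_cyclotomic =
  fixes p c m :: nat and z :: complex
  assumes p: "prime p" and c: "c > 0" and m: "\<not> p dvd m" "m > 0" and z: "proot (m * p ^ c) z"
begin

text \<open>\<open>z ^ m\<close> is a primitive \<open>p ^ c\<close>-th root of unity, so
  \<open>lam\<close> generates the only prime over \<open>p\<close> in the \<open>p\<close>-part of
  the ring. Congruences modulo its powers stand in for the primes of the full ring.\<close>

abbreviation lam where "lam \<equiv> 1 - z ^ m"

lemma zcong_lam_power: "zcong z lam (z ^ (1 + m * i)) z"
proof -
  have "z ^ (1 + m * i) = z * (z ^ m) ^ i" by (simp add: power_mult)
  hence "z ^ (1 + m * i) - z = - z * (1 - (z ^ m) ^ i)" by (simp add: right_diff_distrib)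
  also have "1 - (z ^ m) ^ i = lam * (\<Sum>j<i. (z ^ m) ^ j)" by (rule one_diff_power_eq)
  also have "- z * (lam * (\<Sum>j<i. (z ^ m) ^ j)) = lam * ieval (- monom 1 1 * (\<Sum>j<i. monom 1 (m * j))) z"
    by (simp add: ieval_sum power_mult)
  finally show ?thesis unfolding zcong_def by blast
qed

lemma zcong_lam_ieval: "zcong z lam (ieval f (z ^ (1 + m * i))) (ieval f z)"
proof -
  obtain g where "z ^ (1 + m * i) - z = lam * ieval g z"
    using zcong_lam_power[of i] by (auto simp: zcong_def)
  thus ?thesis using zcong_ieval_power[of z "1 + m * i" f] zcong_weaken by metis
qed

text \<open>For \<open>y\<close> of order \<open>p\<close> the powers of \<open>y\<close> sum to 0,
  so \<open>p\<close> is the sum of the \<open>1 - y ^ i\<close>; each of these is a multiple of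
  \<open>lam\<close> since \<open>y\<close> is a power of \<open>z ^ m\<close>.\<close>

lemma zcong_lam_prime: "zcong z lam (of_nat p) 0"
proof -
  define n where "n = p ^ (c - 1)"
  define y where "y = z ^ (m * n)"
  have pc: "p ^ c = n * p" using power_minus_mult[OF c, of p] by (simp add: n_def)
  have p1: "p > 1" using p prime_gt_1_nat by blast
  have n0: "n > 0" using p1 by (simp add: n_def)
  have "y \<noteq> 1" using z m n0 p1 unfolding y_def pc proot_def by (auto dest!: dvd_imp_le)
  moreover have "y ^ p = 1" using z unfolding y_def pc proot_def by (simp flip: power_mult add: mult.assoc)
  ultimately have 0: "(\<Sum>i<p. y ^ i) = 0" by (simp add: sum_powers_root_of_unity)
  have "of_nat p = (\<Sum>i<p. 1 - y ^ i)" using 0 by (simp add: sum_subtractf)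
  also have "\<dots> = (\<Sum>i<p. 1 - (z ^ m) ^ (n * i))" by (simp add: y_def power_mult)
  also have "\<dots> = (\<Sum>i<p. lam * (\<Sum>j<n * i. (z ^ m) ^ j))" by (simp only: one_diff_power_eq)
  also have "\<dots> = lam * ieval (\<Sum>i<p. \<Sum>j<n * i. monom 1 (m * j)) z"
    by (simp add: ieval_sum power_mult sum_distrib_left)
  finally show ?thesis unfolding zcong_def by auto
qed

text \<open>Modulo \<open>p\<close>, hence modulo \<open>lam\<close>, raising to the power
  \<open>p ^ s\<close> replaces \<open>z\<close> by \<open>z ^ (p ^ s)\<close>. That exponent is 1
  modulo \<open>m\<close>, and modulo \<open>lam\<close> the factor \<open>z ^ m\<close> is
  1.\<close>

lemma zcong_lam_frobenius:
  assumes "[p ^ s = 1] (mod m)"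
  shows "zcong z lam (ieval f z ^ (p ^ s)) (ieval f z)"
proof -
  obtain r where r: "of_nat p = lam * ieval r z" using zcong_lam_prime by (auto simp: zcong_def)
  obtain k where k: "f ^ (p ^ s) - f \<circ>\<^sub>p monom 1 (p ^ s) = of_nat p * k"
    using frobenius_poly_power[OF p, of f s] by blast
  have "ieval f z ^ (p ^ s) - ieval f (z ^ (p ^ s)) = ieval (f ^ (p ^ s) - f \<circ>\<^sub>p monom 1 (p ^ s)) z"
    by simp
  also have "\<dots> = lam * ieval (r * k) z" unfolding k using r by (simp add: of_nat_poly)
  finally have 1: "zcong z lam (ieval f z ^ (p ^ s)) (ieval f (z ^ (p ^ s)))"
    unfolding zcong_def by blast
  have "p ^ s \<ge> 1" using p prime_gt_0_nat by (simp add: Suc_leI)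
  hence "m dvd p ^ s - 1" using assms by (metis cong_sym_eq cong_altdef_nat)
  then obtain i where "p ^ s - 1 = m * i" by blast
  hence "p ^ s = 1 + m * i" using \<open>p ^ s \<ge> 1\<close> by simp
  hence "zcong z lam (ieval f (z ^ (p ^ s))) (ieval f z)" using zcong_lam_ieval by metis
  with 1 show ?thesis by (rule zcong_trans)
qed

text \<open>Each \<open>p\<close>-th power gains a factor \<open>lam\<close>: the cofactor of
  \<open>F - G\<close> in \<open>F ^ p - G ^ p\<close> is congruent to
  \<open>p * G ^ (p - 1)\<close>, which vanishes modulo \<open>lam\<close>.\<close>

lemma zcong_lam_lift:
  assumes "zcong z lam (ieval f z) (ieval g z)"
  shows "zcong z (lam ^ Suc k) (ieval f z ^ (p ^ k)) (ieval g z ^ (p ^ k))"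
proof (induction k)
  case 0
  thus ?case using assms by simp
next
  case (Suc k)
  obtain h where h: "ieval f z ^ (p ^ k) - ieval g z ^ (p ^ k) = lam ^ Suc k * ieval h z"
    using Suc.IH by (auto simp: zcong_def)
  define F G where "F = f ^ (p ^ k)" and "G = g ^ (p ^ k)"
  have FG: "zcong z lam (ieval F z) (ieval G z)"
    using zcong_power[OF assms, of "p ^ k"] by (simp add: F_def G_def)
  have "zcong z lam (\<Sum>i<p. ieval G z ^ (p - Suc i) * ieval F z ^ i)
          (\<Sum>i<p. ieval G z ^ (p - Suc i) * ieval G z ^ i)"
    by (intro zcong_sum) (use zcong_mult[OF zcong_power[OF FG], of "G ^ _"] in simp)
  also have "(\<Sum>i<p. ieval G z ^ (p - Suc i) * ieval G z ^ i) = (\<Sum>i<p. ieval G z ^ (p - 1))"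
    by (intro sum.cong) (auto simp flip: power_add)
  also have "\<dots> = ieval (G ^ (p - 1)) z * of_nat p" by simp
  also have "zcong z lam \<dots> (ieval (G ^ (p - 1)) z * 0)"
    by (intro zcong_mult zcong_lam_prime)
  finally obtain w where w: "(\<Sum>i<p. ieval G z ^ (p - Suc i) * ieval F z ^ i) = lam * ieval w z"
    by (auto simp: zcong_def)
  have "ieval f z ^ (p ^ Suc k) - ieval g z ^ (p ^ Suc k) = ieval F z ^ p - ieval G z ^ p"
    by (simp add: F_def G_def mult.commute flip: power_mult)
  also have "\<dots> = (ieval F z - ieval G z) * (\<Sum>i<p. ieval G z ^ (p - Suc i) * ieval F z ^ i)"
    by (rule power_diff_sumr2)
  also have "ieval F z - ieval G z = lam ^ Suc k * ieval h z" using h by (simp add: F_def G_def)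
  also note w
  also have "lam ^ Suc k * ieval h z * (lam * ieval w z) = lam ^ Suc (Suc k) * ieval (h * w) z" by simp
  finally show ?case unfolding zcong_def by blast
qed

text \<open>
  Every ideal over \<open>p\<close> is invariant under the conjugation. Instead of factoring into primes, use
  \<open>E = f ^ ((q - 1) * p ^ k)\<close>, which modulo \<open>lam ^ (k + 1)\<close> is an idempotent fixed by the
  conjugation: \<open>E\<close> lies in the ideal of \<open>f\<close>, and \<open>(1 - E) * f\<close> is divisible by \<open>lam\<close>,
  so induction applies to the quotient.
\<close>
lemma galois_conj_in_ideal:
  assumes t: "coprime t p" "t = 1 + m * i"
  shows "\<exists>g w. ieval f (z ^ t) = ieval f z * ieval g z + lam ^ k * ieval w z"
proof (induction k arbitrary: f)
  case 0
  show ?case by (intro exI[of _ 0] exI[of _ "f \<circ>\<^sub>p monom 1 t"]) simp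
next
  case (Suc k)
  have "coprime t m" unfolding t(2) by (metis coprime_1_left coprime_mult_self_left_iff coprime_add_one_left coprime_iff_gcd_eq_1 gcd_add_mult gcd.commute add.commute mult.commute)
  hence tN: "coprime t (m * p ^ c)" using t by auto
  define s where "s = totient m"
  have "s > 0" using m by (simp add: s_def)
  have "coprime p m" using p m by (simp add: prime_imp_coprime)
  hence qm: "[p ^ s = 1] (mod m)" unfolding s_def by (rule euler_theorem)
  define q where "q = p ^ s"
  have "q > 1" using p \<open>s > 0\<close> unfolding q_def by (metis one_less_power prime_gt_1_nat)
  \<comment> \<open>The exponent \<open>q - 1\<close> alone gives an idempotent modulo
    \<open>lam\<close>; the extra factor \<open>p ^ k\<close> lifts its invariance under the
    conjugation to the precision \<open>lam ^ Suc k\<close>.\<close>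
  define n where "n = (q - 1) * p ^ k"
  have "n > 0" using \<open>q > 1\<close> p by (simp add: n_def prime_gt_0_nat)
  define E where "E = f ^ n"
  have a: "zcong z lam (ieval f z ^ (1 + (q - 1) * j)) (ieval f z)" for j
  proof (induction j)
    case (Suc j)
    have "1 + (q - 1) * Suc j = (q - 1) + (1 + (q - 1) * j)" by simp
    hence "ieval f z ^ (1 + (q - 1) * Suc j) = ieval (f ^ (q - 1)) z * ieval f z ^ (1 + (q - 1) * j)"
      by (simp only: power_add ieval_simps)
    also have "zcong z lam \<dots> (ieval (f ^ (q - 1)) z * ieval f z)"
      by (rule zcong_mult[OF Suc.IH])
    also have "ieval (f ^ (q - 1)) z * ieval f z = ieval f z ^ q"
      using \<open>q > 1\<close> power_minus_mult[of q "ieval f z"] by simp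
    also have "zcong z lam \<dots> (ieval f z)" unfolding q_def by (rule zcong_lam_frobenius[OF qm])
    finally show ?case .
  qed auto
  obtain f' where f': "ieval f z - ieval f z * ieval E z = lam * ieval f' z"
    using zcong_sym[OF a[of "p ^ k"]] by (auto simp: zcong_def E_def n_def)
  \<comment> \<open>A relation in Z[z] has to be phrased as a vanishing polynomial value before it
    can be conjugated.\<close>
  have "ieval ((1 - E) * f - (1 - monom 1 m) * f') z = 0"
    using f' by (simp add: algebra_simps)
  hence "ieval ((1 - E) * f - (1 - monom 1 m) * f') (z ^ t) = 0"
    by (rule ieval_power_coprime_eq_0[OF z tN])
  hence 1: "(1 - ieval E (z ^ t)) * ieval f (z ^ t) = (1 - (z ^ m) ^ t) * ieval f' (z ^ t)"
    by (simp add: mult.commute flip: power_mult)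
  have 2: "1 - (z ^ m) ^ t = lam * ieval (\<Sum>j<t. monom 1 (m * j)) z"
    unfolding one_diff_power_eq by (simp add: ieval_sum power_mult)
  obtain g w where IH: "ieval f' (z ^ t) = ieval f' z * ieval g z + lam ^ k * ieval w z"
    using Suc.IH by blast
  define f\<sigma> where "f\<sigma> = f \<circ>\<^sub>p monom 1 t"
  have f\<sigma>: "ieval f\<sigma> z = ieval f (z ^ t)" by (simp add: f\<sigma>_def)
  have "zcong z lam (ieval f\<sigma> z) (ieval f z)" unfolding f\<sigma> t(2) by (rule zcong_lam_ieval)
  hence "zcong z lam (ieval (f\<sigma> ^ (q - 1)) z) (ieval (f ^ (q - 1)) z)"
    using zcong_power by simp
  from zcong_lam_lift[OF this, of k]
  have "zcong z (lam ^ Suc k) (ieval E (z ^ t)) (ieval E z)"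
    by (simp add: E_def n_def f\<sigma> flip: power_mult)
  then obtain d where d: "ieval E (z ^ t) - ieval E z = lam ^ Suc k * ieval d z"
    by (auto simp: zcong_def)
  define S where "S = (\<Sum>j<t. monom (1 :: int) (m * j))"
  have E: "ieval E z = ieval f z * ieval (f ^ (n - 1)) z"
    using \<open>n > 0\<close> power_minus_mult[of n "ieval f z"] by (simp add: E_def mult.commute)
  \<comment> \<open>The first summand lies in the ideal of \<open>f\<close> because \<open>E\<close>
    is a positive power of \<open>f\<close>, the second does so up to \<open>lam ^ Suc k\<close> by
    induction, and the third is a multiple of \<open>lam ^ Suc k\<close>.\<close>
  have "ieval f (z ^ t) = ieval E z * ieval f\<sigma> z + (1 - ieval E (z ^ t)) * ieval f (z ^ t)
      + (ieval E (z ^ t) - ieval E z) * ieval f\<sigma> z" by (simp add: f\<sigma> algebra_simps)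
  also have "(1 - ieval E (z ^ t)) * ieval f (z ^ t) =
      ieval S z * ((lam * ieval f' z) * ieval g z + lam ^ Suc k * ieval w z)"
    unfolding 1 2 IH S_def by (simp add: algebra_simps)
  also have "lam * ieval f' z = ieval f z * (1 - ieval E z)" unfolding f'[symmetric] by (simp add: right_diff_distrib)
  finally have "ieval f (z ^ t) = ieval f z * ieval (f ^ (n - 1) * f\<sigma> + S * g * (1 - E)) z
      + lam ^ Suc k * ieval (S * w + d * f\<sigma>) z"
    unfolding d by (simp add: E algebra_simps)
  thus ?case by blast
qed

text \<open>\<open>lam ^ (p ^ c)\<close> is a multiple of \<open>p\<close>, so
  \<open>lam ^ (p ^ c * n)\<close> is a multiple of \<open>p ^ n\<close>, the product of
  \<open>ieval f z\<close> and its complex conjugate. At this precision the error term is itself a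
  multiple of \<open>ieval f z\<close>.\<close>

lemma galois_conj_dvd:
  assumes t: "coprime t p" "t = 1 + m * i"
    and f: "ieval f z * cnj (ieval f z) = of_nat (p ^ n)"
  shows "\<exists>g. ieval f (z ^ t) = ieval g z * ieval f z"
proof -
  have N: "m * p ^ c > 0" "z ^ (m * p ^ c) = 1" using z by (auto simp: proot_def)
  have cnj: "cnj (ieval f z) = ieval (f \<circ>\<^sub>p monom 1 (m * p ^ c - 1)) z"
    by (simp add: ieval_cnj cnj_power_root_of_unity[OF N(2,1)])
  define L where "L = 1 - monom (1 :: int) m"
  obtain k where k: "L ^ (p ^ c) - L \<circ>\<^sub>p monom 1 (p ^ c) = of_nat p * k"
    using frobenius_poly_power[OF p, of L c] by blast
  have "lam ^ (p ^ c) = ieval (L ^ (p ^ c) - L \<circ>\<^sub>p monom 1 (p ^ c)) z"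
    using N(2) by (simp add: L_def mult.commute flip: power_mult)
  also have "\<dots> = of_nat p * ieval k z" unfolding k by (simp add: of_nat_poly)
  finally have lam: "lam ^ (p ^ c * n) = of_nat (p ^ n) * ieval (k ^ n) z"
    by (simp add: power_mult power_mult_distrib)
  obtain g w where "ieval f (z ^ t) = ieval f z * ieval g z + lam ^ (p ^ c * n) * ieval w z"
    using galois_conj_in_ideal[OF t] by blast
  also have "lam ^ (p ^ c * n) = ieval f z * ieval (f \<circ>\<^sub>p monom 1 (m * p ^ c - 1)) z * ieval (k ^ n) z"
    unfolding lam f[symmetric] cnj by simp
  finally have "ieval f (z ^ t) = ieval (g + (f \<circ>\<^sub>p monom 1 (m * p ^ c - 1)) * k ^ n * w) z * ieval f z"
    by (simp add: algebra_simps)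
  thus ?thesis by blast
qed

text \<open>Complex conjugation is the Galois conjugation with exponent \<open>N - 1\<close>, so the
  norm equation for \<open>f\<close> holds at every conjugate. All conjugates of the quotient thus
  have absolute value 1, and Kronecker's theorem applies.\<close>

lemma galois_conj_root_of_unity:
  assumes t: "coprime t p" "t = 1 + m * i"
    and f: "ieval f z * cnj (ieval f z) = of_nat (p ^ n)"
  shows "\<exists>u M. M > 0 \<and> u ^ M = 1 \<and> ieval f (z ^ t) = u * ieval f z"
proof -
  define N where "N = m * p ^ c"
  have zN: "proot N z" using z by (simp add: N_def)
  have N: "N > 0" "z ^ N = 1" using zN by (auto simp: proot_def)
  have "coprime t m" unfolding t(2) by (metis coprime_1_left coprime_mult_self_left_iff coprime_add_one_left coprime_iff_gcd_eq_1 gcd_add_mult gcd.commute add.commute mult.commute)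
  hence tN: "coprime t N" using t by (auto simp: N_def)
  obtain g where g: "ieval f (z ^ t) = ieval g z * ieval f z"
    using galois_conj_dvd[OF assms] by blast
  have norm: "cmod (ieval f (z ^ s)) ^ 2 = p ^ n" if s: "coprime s N" for s
  proof -
    have zs: "(z ^ s) ^ N = 1" using N by (metis power_commutes power_mult power_one mult.commute)
    have cnj: "cnj (ieval f y) = ieval f (y ^ (N - 1))" if "y ^ N = 1" for y
      by (simp add: ieval_cnj cnj_power_root_of_unity[OF that N(1)])
    have "ieval (f * (f \<circ>\<^sub>p monom 1 (N - 1)) - [:int (p ^ n):]) z = 0"
      using f cnj[OF N(2)] by simp
    hence "ieval (f * (f \<circ>\<^sub>p monom 1 (N - 1)) - [:int (p ^ n):]) (z ^ s) = 0"
      by (rule ieval_power_coprime_eq_0[OF zN s])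
    hence "ieval f (z ^ s) * cnj (ieval f (z ^ s)) = of_nat (p ^ n)"
      using cnj[OF zs] by simp
    hence "complex_of_real (cmod (ieval f (z ^ s)) ^ 2) = of_real (real (p ^ n))"
      unfolding complex_norm_square of_real_of_nat_eq .
    thus ?thesis by (simp only: of_real_eq_iff)
  qed
  have "cmod (ieval g (z ^ s)) = 1" if s: "coprime s N" for s
  proof -
    have "ieval (f \<circ>\<^sub>p monom 1 t - g * f) z = 0" using g by simp
    hence "ieval (f \<circ>\<^sub>p monom 1 t - g * f) (z ^ s) = 0"
      by (rule ieval_power_coprime_eq_0[OF zN s])
    hence "ieval f (z ^ (s * t)) = ieval g (z ^ s) * ieval f (z ^ s)" by (simp add: power_mult)
    hence "cmod (ieval f (z ^ (s * t))) ^ 2 = cmod (ieval g (z ^ s)) ^ 2 * cmod (ieval f (z ^ s)) ^ 2"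
      by (simp add: norm_mult power_mult_distrib)
    hence "real (p ^ n) = cmod (ieval g (z ^ s)) ^ 2 * real (p ^ n)"
      using norm[of "s * t"] norm[OF s] s tN by simp
    hence "cmod (ieval g (z ^ s)) ^ 2 = 1" using p by (simp add: prime_gt_0_nat)
    thus ?thesis by (simp add: power2_eq_1_iff) (smt (verit) norm_ge_zero)
  qed
  from kronecker_root_of_unity[OF zN this] g show ?thesis by blast
qed

end

section \<open>Perfect sequences of prime power period\<close>

lemma root_power_cong:
  fixes y :: complex
  assumes "y ^ n = 1" "[i = j] (mod n)"
  shows "y ^ i = y ^ j"
proof -
  have "y ^ i = y ^ (i mod n)" for i
  proof -
    have "y ^ i = y ^ (n * (i div n) + i mod n)" by simp
    also have "\<dots> = y ^ (i mod n)" using assms(1) by (simp only: power_add power_mult) simp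
    finally show ?thesis .
  qed
  thus ?thesis using assms(2) unfolding cong_def by metis
qed

lemma root_of_unity_eq_power:
  assumes "proot N z" "y ^ N = 1"
  obtains e where "y = z ^ e"
proof -
  have N: "N > 0" using assms by (simp add: proot_def)
  have "(\<lambda>k. z ^ k) ` {..<N} = {y. y ^ N = 1}"
  proof (rule card_subset_eq)
    show "finite {y::complex. y ^ N = 1}" using N by (intro finite_roots_unity) auto
    show "(\<lambda>k. z ^ k) ` {..<N} \<subseteq> {y. y ^ N = 1}"
      using assms(1) by (auto simp: proot_def simp flip: power_mult)
    have "inj_on (\<lambda>k. z ^ k) {..<N}"
      using proot_power_eq_iff[OF assms(1)] by (auto simp: inj_on_def cong_def)
    hence "card ((\<lambda>k. z ^ k) ` {..<N}) = N" by (simp add: card_image)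
    thus "card ((\<lambda>k. z ^ k) ` {..<N}) = card {y::complex. y ^ N = 1}"
      using card_roots_unity_eq[OF N] by simp
  qed
  thus ?thesis using assms(2) that by blast
qed

lemma root_of_unity_split:
  fixes u :: complex
  assumes "u ^ (A * B) = 1" "coprime A B"
  obtains x y where "u = x * y" "x ^ A = 1" "y ^ B = 1"
proof -
  obtain i where i: "[i = 1] (mod A)" "[i = 0] (mod B)"
    using binary_chinese_remainder_nat[OF assms(2)] by blast
  obtain j where j: "[j = 0] (mod A)" "[j = 1] (mod B)"
    using binary_chinese_remainder_nat[OF assms(2)] by blast
  have "[i + j = 1 + 0] (mod A)" "[i + j = 0 + 1] (mod B)" using i j by (intro cong_add; simp)+
  hence "[i + j = 1] (mod A * B)" using assms(2) by (intro coprime_cong_mult_nat) auto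
  hence "u ^ (i + j) = u ^ 1" by (rule root_power_cong[OF assms(1)])
  hence "u = u ^ i * u ^ j" by (simp add: power_add)
  moreover have "(u ^ i) ^ A = 1"
  proof -
    obtain i' where "i = B * i'" using i(2) by (auto simp: cong_0_iff)
    hence "(u ^ i) ^ A = (u ^ (A * B)) ^ i'" by (simp flip: power_mult add: mult_ac)
    thus ?thesis using assms(1) by simp
  qed
  moreover have "(u ^ j) ^ B = 1"
  proof -
    obtain j' where "j = A * j'" using j(1) by (auto simp: cong_0_iff)
    hence "(u ^ j) ^ B = (u ^ (A * B)) ^ j'" by (simp flip: power_mult add: mult_ac)
    thus ?thesis using assms(1) by simp
  qed
  ultimately show ?thesis using that by blast
qed

lemma root_of_unity_coprime_orders:
  fixes u :: complex
  assumes "u ^ A = 1" "u ^ B = 1" "coprime A B"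
  shows "u = 1"
proof -
  obtain i where i: "[i = 1] (mod A)" "[i = 0] (mod B)"
    using binary_chinese_remainder_nat[OF assms(3)] by blast
  have "u ^ i = u ^ 1" by (rule root_power_cong[OF assms(1) i(1)])
  moreover have "u ^ i = u ^ 0" by (rule root_power_cong[OF assms(2) i(2)])
  ultimately show ?thesis by simp
qed

lemma periodic_cong:
  fixes f :: "nat \<Rightarrow> 'a"
  assumes "\<And>x. f (x + v) = f x" "[x = y] (mod v)"
  shows "f x = f y"
proof -
  have "f (x + v * n) = f x" for x n
  proof (induction n)
    case (Suc n)
    have "x + v * Suc n = (x + v * n) + v" by simp
    thus ?case using assms(1) Suc.IH by presburger
  qed simp
  hence "f x = f (x mod v)" for x by (metis mod_mult_div_eq)
  thus ?thesis using assms(2) unfolding cong_def by metis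
qed

lemma sum_periodic_shift:
  fixes f :: "nat \<Rightarrow> 'a :: ab_group_add"
  assumes "\<And>x. f (x + v) = f x"
  shows "(\<Sum>x<v. f (x + l)) = (\<Sum>x<v. f x)"
proof (induction l)
  case (Suc l)
  define g where "g x = f (x + l)" for x
  have "(\<Sum>x<v. f (x + Suc l)) = (\<Sum>x<v. g (Suc x))" by (simp add: g_def)
  also have "\<dots> = (\<Sum>x<Suc v. g x) - g 0" by (subst sum.lessThan_Suc_shift) simp
  also have "\<dots> = (\<Sum>x<v. g x) + g v - g 0" by simp
  also have "g v = g 0" using assms[of l] by (simp add: g_def add.commute)
  finally show ?case using Suc.IH by (simp add: g_def)
qed auto

lemma sum_nat_blocks:
  fixes f :: "nat \<Rightarrow> 'a :: comm_monoid_add"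
  shows "(\<Sum>k<d * q. f k) = (\<Sum>r<d. \<Sum>n<q. f (r + d * n))"
proof -
  have "(\<Sum>k<q * d. f k) = (\<Sum>n<q. sum f {n * d..<n * d + d})"
    by (rule sum.nat_group [symmetric])
  also have "\<dots> = (\<Sum>n<q. \<Sum>r<d. f (r + d * n))"
  proof (rule sum.cong[OF refl])
    fix n
    show "sum f {n * d..<n * d + d} = (\<Sum>r<d. f (r + d * n))"
      using sum.shift_bounds_nat_ivl[of f 0 "n * d" d] by (simp add: atLeast0LessThan add_ac mult_ac)
  qed
  also have "\<dots> = (\<Sum>r<d. \<Sum>n<q. f (r + d * n))" by (rule sum.swap)
  finally show ?thesis by (simp add: mult.commute)
qed

lemma card_residue_class_le:
  assumes "d > 0"
  shows "card {x. x < d * q \<and> [x = g] (mod d)} \<le> q"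
proof -
  have "{x. x < d * q \<and> [x = g] (mod d)} \<subseteq> (\<lambda>i. g mod d + d * i) ` {..<q}"
  proof
    fix x assume x: "x \<in> {x. x < d * q \<and> [x = g] (mod d)}"
    hence "x div d < q" using assms by (simp add: less_mult_imp_div_less mult.commute)
    moreover have "x = g mod d + d * (x div d)" using x by (metis (mono_tags, lifting) cong_def mem_Collect_eq mod_mult_div_eq)
    ultimately show "x \<in> (\<lambda>i. g mod d + d * i) ` {..<q}" by blast
  qed
  from card_mono[OF _ this] card_image_le[of "{..<q}" "\<lambda>i. g mod d + d * i"] show ?thesis by simp
qed

section \<open>Fourier analysis of a perfect sequence\<close>

locale prime_power_seq =
  fixes p a :: nat and c :: "nat \<Rightarrow> complex"
  assumes p: "prime p" and a: "a > 0"
    and periodic: "c (x + p ^ a) = c x"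
    and norm_c: "cmod (c x) = 1"
    and orth: "\<not> p ^ a dvd l \<Longrightarrow> (\<Sum>x<p ^ a. c (x + l) * cnj (c x)) = 0"
begin

definition w :: complex where "w = cis (2 * pi / real (p ^ a))"

definition X :: "nat \<Rightarrow> complex" where "X k = (\<Sum>x<p ^ a. c x * w ^ (k * x))"

lemma v_pos: "p ^ a > 0"
  using p prime_gt_0_nat by simp

lemma w: "proot (p ^ a) w"
  unfolding w_def by (rule proot_cis[OF v_pos])

lemma w_one [simp]: "w ^ (p ^ a) = 1" "cnj w ^ (p ^ a) = 1"
  using w unfolding proot_def by (auto simp flip: complex_cnj_power)

lemma w_cong: "[i = j] (mod p ^ a) \<Longrightarrow> w ^ i = w ^ j"
  using proot_power_eq_iff[OF w] by blast

lemma w_cnj: "w * cnj w = 1" "cnj w * w = 1"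
  using proot_norm[OF w] by (simp_all add: mult.commute[of "cnj w"] flip: complex_norm_square)

lemma c_cnj: "c x * cnj (c x) = 1" "cnj (c x) * c x = 1"
  using norm_c[of x] by (simp_all add: mult.commute[of "cnj (c x)"] flip: complex_norm_square)

lemma X_cong: "[k = l] (mod p ^ a) \<Longrightarrow> X k = X l"
  unfolding X_def by (intro sum.cong refl arg_cong2[where f = "(*)"] w_cong cong_mult) auto

lemma c_cong: "[x = y] (mod p ^ a) \<Longrightarrow> c x = c y"
  by (rule periodic_cong[of c, OF periodic])

lemma sum_c_cnj:
  "(\<Sum>x<p ^ a. c (x + l) * cnj (c x)) = (if p ^ a dvd l then of_nat (p ^ a) else 0)"
proof (cases "p ^ a dvd l")
  case True
  have "c (x + l) = c x" for x by (rule c_cong) (use True in \<open>simp add: cong_def mod_add_right_eq[symmetric]\<close>)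
  thus ?thesis using True by (simp add: c_cnj)
qed (use orth in simp)

lemma sum_w_powers:
  "(\<Sum>t<p ^ a. (w ^ i * cnj w ^ j) ^ t) = (if [i = j] (mod p ^ a) then of_nat (p ^ a) else 0)"
  by (rule sum_proot_quotient_powers[OF w])

text \<open>Wiener-Khinchin: the power spectrum is the transform of the autocorrelation, which is
  concentrated at 0.\<close>

lemma X_norm: "X k * cnj (X k) = of_nat (p ^ a)"
proof -
  have per: "c (x + p ^ a) * w ^ (k * (x + p ^ a)) = c x * w ^ (k * x)" for x
    using periodic[of x] w_cong[of "k * (x + p ^ a)" "k * x"] by (simp add: cong_def algebra_simps)
  have "X k * cnj (X k) = (\<Sum>y<p ^ a. (\<Sum>x<p ^ a. c x * w ^ (k * x)) * cnj (c y) * cnj w ^ (k * y))"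
    by (simp add: X_def sum_distrib_left mult_ac)
  also have "\<dots> = (\<Sum>y<p ^ a. (\<Sum>x<p ^ a. c (x + y) * w ^ (k * (x + y))) * cnj (c y) * cnj w ^ (k * y))"
    using sum_periodic_shift[of "\<lambda>x. c x * w ^ (k * x)" "p ^ a", OF per] by simp
  also have "\<dots> = (\<Sum>y<p ^ a. \<Sum>x<p ^ a. w ^ (k * x) * (c (y + x) * cnj (c y)))"
  proof (intro sum.cong refl)
    fix y
    have "w ^ (k * y) * cnj w ^ (k * y) = 1" by (simp add: w_cnj flip: power_mult_distrib)
    hence *: "w ^ (k * (x + y)) * cnj w ^ (k * y) = w ^ (k * x)" for x
      by (simp add: distrib_left power_add mult.assoc)
    have "(\<Sum>x<p ^ a. c (x + y) * w ^ (k * (x + y))) * cnj (c y) * cnj w ^ (k * y) =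
       (\<Sum>x<p ^ a. (w ^ (k * (x + y)) * cnj w ^ (k * y)) * (c (y + x) * cnj (c y)))"
      by (simp add: sum_distrib_left sum_distrib_right mult_ac add.commute)
    thus "(\<Sum>x<p ^ a. c (x + y) * w ^ (k * (x + y))) * cnj (c y) * cnj w ^ (k * y) =
       (\<Sum>x<p ^ a. w ^ (k * x) * (c (y + x) * cnj (c y)))" by (simp only: *)
  qed
  also have "\<dots> = (\<Sum>x<p ^ a. w ^ (k * x) * (\<Sum>y<p ^ a. c (y + x) * cnj (c y)))"
    by (subst sum.swap) (simp add: sum_distrib_left)
  also have "\<dots> = (\<Sum>x<p ^ a. if x = 0 then of_nat (p ^ a) else 0)"
    by (intro sum.cong refl) (auto simp: sum_c_cnj dest: dvd_imp_le)
  also have "\<dots> = of_nat (p ^ a)" using v_pos by simp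
  finally show ?thesis .
qed

lemma X_nonzero: "X k \<noteq> 0"
  using X_norm[of k] v_pos by auto

lemma fourier_inversion: "(\<Sum>k<p ^ a. X k * cnj w ^ (k * x)) = of_nat (p ^ a) * c x"
proof -
  have "(\<Sum>k<p ^ a. X k * cnj w ^ (k * x)) = (\<Sum>y<p ^ a. c y * (\<Sum>k<p ^ a. (w ^ y * cnj w ^ x) ^ k))"
    unfolding X_def sum_distrib_right sum_distrib_left
    by (subst sum.swap) (simp add: power_mult_distrib mult_ac flip: power_mult)
  also have "\<dots> = (\<Sum>y<p ^ a. if y = x mod p ^ a then of_nat (p ^ a) * c y else 0)"
    by (intro sum.cong refl) (auto simp: sum_w_powers cong_def)
  also have "\<dots> = of_nat (p ^ a) * c (x mod p ^ a)" using v_pos by simp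
  also have "c (x mod p ^ a) = c x" by (rule c_cong) simp
  finally show ?thesis .
qed

definition avg :: "nat \<Rightarrow> complex" where
  "avg x = (\<Sum>i<p. c (x + i * p ^ (a - 1))) / of_nat p"

lemma pa: "p ^ a = p * p ^ (a - 1)"
  using a by (simp add: power_eq_if)

text \<open>Of the \<open>p ^ 2\<close> correlations between translates within a coset only the
  \<open>p\<close> diagonal ones survive, each equal to \<open>p ^ a\<close>.\<close>

lemma sum_norm_avg: "(\<Sum>x<p ^ a. cmod (avg x) ^ 2) = real (p ^ (a - 1))"
proof -
  define q where "q = p ^ (a - 1)"
  have p0: "p > 0" using p prime_gt_0_nat by simp
  have q0: "q > 0" using p0 by (simp add: q_def)
  have pq: "p ^ a = p * q" using pa by (simp add: q_def)
  have corr: "(\<Sum>x<p ^ a. c (x + i * q) * cnj (c (x + j * q))) = (if i = j then of_nat (p ^ a) else 0)"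
    if "i < p" "j < p" for i j
  proof -
    \<comment> \<open>\<open>(p - j) * q\<close> represents the shift by \<open>- j * q\<close>,
      since \<open>p * q\<close> is the period.\<close>
    define g where "g y = c (y + (i * q + (p - j) * q)) * cnj (c y)" for y
    have g_per: "g (y + p ^ a) = g y" for y
      using periodic[of y] periodic[of "y + (i * q + (p - j) * q)"] by (simp add: g_def add_ac)
    have "c (x + i * q) * cnj (c (x + j * q)) = g (x + j * q)" for x
    proof -
      have "j * q + (p - j) * q = p ^ a" using that by (simp add: pq flip: add_mult_distrib)
      hence "x + j * q + (i * q + (p - j) * q) = (x + i * q) + p ^ a" by simp
      thus ?thesis unfolding g_def using periodic[of "x + i * q"] by presburger
    qed
    hence "(\<Sum>x<p ^ a. c (x + i * q) * cnj (c (x + j * q))) = (\<Sum>x<p ^ a. g (x + j * q))" by simp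
    also have "\<dots> = (\<Sum>x<p ^ a. g x)" by (rule sum_periodic_shift[of g "p ^ a", OF g_per])
    also have "\<dots> = (if p ^ a dvd i * q + (p - j) * q then of_nat (p ^ a) else 0)"
      unfolding g_def by (rule sum_c_cnj)
    also have "p ^ a dvd i * q + (p - j) * q \<longleftrightarrow> p dvd i + (p - j)"
      unfolding pq using q0 by (simp flip: add_mult_distrib)
    also have "\<dots> \<longleftrightarrow> i = j"
    proof
      assume "p dvd i + (p - j)"
      then obtain t where t: "i + (p - j) = p * t" by blast
      have "0 < p * t" "p * t < p * 2" using that t by linarith+
      hence "t = 1" using p0 by (simp add: )
      thus "i = j" using t that by simp
    qed (use that in simp)
    finally show ?thesis .
  qed
  have "(\<Sum>x<p ^ a. avg x * cnj (avg x)) =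
    (\<Sum>x<p ^ a. \<Sum>i<p. \<Sum>j<p. c (x + i * q) * cnj (c (x + j * q))) / of_nat p ^ 2"
    by (simp add: avg_def q_def sum_product sum_divide_distrib power2_eq_square)
  also have "(\<Sum>x<p ^ a. \<Sum>i<p. \<Sum>j<p. c (x + i * q) * cnj (c (x + j * q))) =
     (\<Sum>i<p. \<Sum>j<p. \<Sum>x<p ^ a. c (x + i * q) * cnj (c (x + j * q)))"
    by (subst sum.swap, rule sum.cong[OF refl], rule sum.swap)
  also have "\<dots> = (\<Sum>i<p. \<Sum>j<p. if i = j then of_nat (p ^ a) else 0)"
    by (intro sum.cong refl corr) auto
  also have "\<dots> = of_nat p * of_nat (p ^ a)" by simp
  also have "\<dots> / of_nat p ^ 2 = of_nat q" using p0 unfolding pq by (simp add: power2_eq_square)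
  finally have "complex_of_real (\<Sum>x<p ^ a. cmod (avg x) ^ 2) = of_real (real q)"
    unfolding of_real_sum complex_norm_square of_real_of_nat_eq .
  thus ?thesis unfolding of_real_eq_iff by (simp add: q_def)
qed

text \<open>Every place outside \<open>S\<close> contributes 1 to the total energy
  \<open>p ^ (a - 1)\<close> of \<open>avg\<close>.\<close>

lemma card_support_ge:
  assumes "S \<subseteq> {..<p ^ a}" "\<And>x. x < p ^ a \<Longrightarrow> x \<notin> S \<Longrightarrow> c x = avg x"
  shows "p ^ a \<le> card S + p ^ (a - 1)"
proof -
  have fin: "finite S" using assms(1) finite_subset by blast
  have "real (p ^ a - card S) = (\<Sum>x\<in>{..<p ^ a} - S. cmod (c x) ^ 2)"
    using assms(1) fin by (simp add: norm_c card_Diff_subset)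
  also have "\<dots> = (\<Sum>x\<in>{..<p ^ a} - S. cmod (avg x) ^ 2)"
    using assms(2) by (intro sum.cong) auto
  also have "\<dots> \<le> (\<Sum>x<p ^ a. cmod (avg x) ^ 2)" by (intro sum_mono2) auto
  also have "\<dots> = real (p ^ (a - 1))" by (rule sum_norm_avg)
  finally have "p ^ a - card S \<le> p ^ (a - 1)" by linarith
  thus ?thesis by linarith
qed

text \<open>Averaging over the subgroup of order \<open>p\<close> is the projection onto the
  frequencies divisible by \<open>p\<close>. What remains are the unit frequencies, on which the
  phases are known.\<close>

lemma diff_avg:
  "of_nat (p ^ a) * (c x - avg x) = (\<Sum>k | k < p ^ a \<and> coprime k p. X k * cnj w ^ (k * x))"
proof -
  define q where "q = p ^ (a - 1)"
  have p0: "p > 0" using p prime_gt_0_nat by simp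
  have q0: "q > 0" using p0 by (simp add: q_def)
  have pq: "p ^ a = p * q" using pa by (simp add: q_def)
  have "(cnj w ^ (k * q)) ^ p = 1" for k
  proof -
    have "(w ^ (k * q)) ^ p = (w ^ (p ^ a)) ^ k" by (simp add: pq mult_ac flip: power_mult)
    also have "\<dots> = 1" by simp
    finally show ?thesis by (metis complex_cnj_one complex_cnj_power)
  qed
  moreover have "cnj w ^ (k * q) = 1 \<longleftrightarrow> \<not> coprime k p" for k
  proof -
    have "cnj w ^ (k * q) = 1 \<longleftrightarrow> w ^ (k * q) = 1" by (metis complex_cnj_one complex_cnj_power complex_cnj_cnj)
    also have "\<dots> \<longleftrightarrow> p * q dvd k * q" using w by (simp add: proot_def pq)
    also have "\<dots> \<longleftrightarrow> p dvd k" using q0 by simp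
    also have "\<dots> \<longleftrightarrow> \<not> coprime k p" using p by (metis coprime_commute prime_imp_coprime coprime_absorb_left not_prime_unit)
    finally show ?thesis .
  qed
  ultimately have inner: "(\<Sum>i<p. (cnj w ^ (k * q)) ^ i) = (if coprime k p then 0 else of_nat p)" for k
    by (simp add: sum_powers_root_of_unity)
  have "of_nat (p ^ a) * avg x = (\<Sum>i<p. of_nat (p ^ a) * c (x + i * q)) / of_nat p"
    by (simp add: avg_def q_def sum_distrib_left)
  also have "(\<Sum>i<p. of_nat (p ^ a) * c (x + i * q)) = (\<Sum>i<p. \<Sum>k<p ^ a. X k * cnj w ^ (k * (x + i * q)))"
    by (simp only: fourier_inversion)
  also have "\<dots> = (\<Sum>k<p ^ a. X k * cnj w ^ (k * x) * (\<Sum>i<p. (cnj w ^ (k * q)) ^ i))"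
    by (subst sum.swap) (simp add: sum_distrib_left algebra_simps power_add flip: power_mult)
  also have "\<dots> / of_nat p = (\<Sum>k<p ^ a. if coprime k p then 0 else X k * cnj w ^ (k * x))"
    unfolding inner sum_divide_distrib by (intro sum.cong) (use p0 in auto)
  finally have "of_nat (p ^ a) * (c x - avg x) =
     (\<Sum>k<p ^ a. X k * cnj w ^ (k * x)) - (\<Sum>k<p ^ a. if coprime k p then 0 else X k * cnj w ^ (k * x))"
    by (simp add: right_diff_distrib fourier_inversion)
  also have "\<dots> = (\<Sum>k<p ^ a. if coprime k p then X k * cnj w ^ (k * x) else 0)"
    unfolding sum_subtractf [symmetric] by (intro sum.cong) auto
  also have "\<dots> = (\<Sum>k | k < p ^ a \<and> coprime k p. X k * cnj w ^ (k * x))"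
    by (simp add: sum.inter_filter [symmetric] lessThan_def)
  finally show ?thesis .
qed

text \<open>For fixed \<open>r\<close> the frequencies \<open>r + p ^ b * n\<close> contribute a
  geometric series whose ratio \<open>y\<close> satisfies \<open>y ^ d = 1\<close>. It vanishes
  unless \<open>y = 1\<close>, that is, unless \<open>x\<close> is \<open>g r\<close> modulo
  \<open>d\<close>.\<close>

lemma eq_avg:
  assumes b: "0 < b" "b \<le> a"
    and g: "\<And>r n. r < p ^ b \<Longrightarrow> coprime r p \<Longrightarrow> X (r + p ^ b * n) = w ^ (g r * p ^ b * n) * X r"
    and x: "\<And>r. r < p ^ b \<Longrightarrow> coprime r p \<Longrightarrow> \<not> [x = g r] (mod p ^ (a - b))"
  shows "c x = avg x"
proof -
  define d where "d = p ^ (a - b)"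
  have p0: "p > 0" using p prime_gt_0_nat by simp
  have pd: "p ^ a = p ^ b * d" using b by (simp add: d_def flip: power_add)
  have cop: "coprime (r + p ^ b * n) p \<longleftrightarrow> coprime r p" for r n
  proof -
    have "p ^ b * n = p * (p ^ (b - 1) * n)" using b by (simp add: power_eq_if)
    thus ?thesis by (metis coprime_commute add.commute gcd_add_mult coprime_iff_gcd_eq_1 mult.commute)
  qed
  have zero: "(\<Sum>n<d. X (r + p ^ b * n) * cnj w ^ ((r + p ^ b * n) * x)) = 0"
    if r: "r < p ^ b" "coprime r p" for r
  proof -
    define y where "y = w ^ (g r * p ^ b) * cnj w ^ (p ^ b * x)"
    have "y \<noteq> 1"
    proof
      assume "y = 1"
      hence "w ^ (g r * p ^ b) * (cnj w * w) ^ (p ^ b * x) = w ^ (p ^ b * x)"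
        by (simp add: y_def power_mult_distrib mult_ac)
      hence "w ^ (g r * p ^ b) = w ^ (p ^ b * x)" by (simp add: w_cnj)
      hence "[g r * p ^ b = x * p ^ b] (mod d * p ^ b)"
        using proot_power_eq_iff[OF w] by (simp add: pd mult.commute)
      hence "[g r = x] (mod d)" using p0
        by (simp add: cong_def mult_mod_left [symmetric])
      thus False using x[OF r] by (simp add: d_def cong_sym_eq)
    qed
    moreover have "y ^ d = 1"
    proof -
      have "y ^ d = (w ^ (p ^ a)) ^ g r * cnj ((w ^ (p ^ a)) ^ x)"
        by (simp add: y_def pd power_mult_distrib mult_ac flip: power_mult)
      thus ?thesis by simp
    qed
    ultimately have "(\<Sum>n<d. y ^ n) = 0" by (simp add: sum_powers_root_of_unity)
    moreover have "X (r + p ^ b * n) * cnj w ^ ((r + p ^ b * n) * x) = X r * cnj w ^ (r * x) * y ^ n" for n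
      unfolding g[OF r] by (simp add: y_def power_mult_distrib algebra_simps power_add flip: power_mult)
    ultimately show ?thesis by (simp flip: sum_distrib_left)
  qed
  have "of_nat (p ^ a) * (c x - avg x) = (\<Sum>k<p ^ a. if coprime k p then X k * cnj w ^ (k * x) else 0)"
    unfolding diff_avg by (simp add: sum.inter_filter [symmetric] lessThan_def)
  also have "\<dots> = (\<Sum>r<p ^ b. \<Sum>n<d. if coprime (r + p ^ b * n) p
      then X (r + p ^ b * n) * cnj w ^ ((r + p ^ b * n) * x) else 0)"
    unfolding pd by (rule sum_nat_blocks)
  also have "\<dots> = (\<Sum>r<p ^ b. 0)"
  proof (rule sum.cong[OF refl])
    fix r assume "r \<in> {..<p ^ b}"
    thus "(\<Sum>n<d. if coprime (r + p ^ b * n) p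
      then X (r + p ^ b * n) * cnj w ^ ((r + p ^ b * n) * x) else 0) = 0"
      using zero by (cases "coprime r p") (simp_all add: cop)
  qed
  finally show ?thesis using p0 by simp
qed

end

section \<open>Generators of the units congruent to 1\<close>

lemma cong_one_plus_mult: "[1 + n * k = 1] (mod n)" for n k :: nat
  by (simp only: cong_def mod_mult_self2)

text \<open>The sum is the cofactor of \<open>y\<close> in \<open>(1 + y) ^ p - 1\<close>, here
  shown to contain exactly one factor \<open>p\<close>. Modulo \<open>y ^ 2\<close> it is
  \<open>p + y * (p * (p - 1) / 2)\<close>; for \<open>p = 2\<close> the division by 2 costs a
  factor, whence the stronger hypothesis \<open>4 dvd y\<close>.\<close>

lemma lifting_exponent_step:
  fixes y :: int and p :: nat
  assumes p: "prime p" and y: "int p dvd y" "p = 2 \<Longrightarrow> 4 dvd y"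
  shows "\<exists>t. (\<Sum>i<p. (1 + y) ^ i) = int p * (1 + int p * t)"
proof (cases "p = 2")
  case True
  from y(2)[OF True] obtain k where "y = 4 * k" by blast
  hence "(\<Sum>i<p. (1 + y) ^ i) = int p * (1 + int p * k)" by (simp add: True numeral_2_eq_2)
  thus ?thesis by blast
next
  case False
  hence "odd p" using p primes_dvd_imp_eq two_is_prime_nat by blast
  then obtain h where h: "p = 2 * h + 1" by (elim oddE)
  obtain k where k: "y = int p * k" using y by blast
  have "\<exists>t. (1 + y) ^ i = 1 + of_nat i * y + y ^ 2 * t" for i
  proof (induction i)
    case (Suc i)
    then obtain t where "(1 + y) ^ i = 1 + of_nat i * y + y ^ 2 * t" by blast
    hence "(1 + y) ^ Suc i = 1 + of_nat (Suc i) * y + y ^ 2 * (of_nat i + t + y * t)"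
      by (simp add: algebra_simps power2_eq_square)
    thus ?case by blast
  qed (intro exI[of _ 0], simp)
  then obtain t where t: "\<And>i. (1 + y) ^ i = 1 + of_nat i * y + y ^ 2 * t i" by metis
  have "(\<Sum>i<n. int i) * 2 = int n * (int n - 1)" for n
    by (induction n) (auto simp: algebra_simps)
  from this[of p] have "(\<Sum>i<p. int i) = int p * int h" unfolding h by (simp add: algebra_simps)
  hence "(\<Sum>i<p. (1 + y) ^ i) = int p + int p * int h * y + y ^ 2 * (\<Sum>i<p. t i)"
    by (simp add: t sum.distrib flip: sum_distrib_left sum_distrib_right)
  also have "\<dots> = int p * (1 + int p * (int h * k + k ^ 2 * (\<Sum>i<p. t i)))"
    unfolding k by (simp add: algebra_simps power2_eq_square)
  finally show ?thesis by blast
qed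

lemma lifting_exponent:
  fixes p b e :: nat
  assumes p: "prime p" and b: "b > 0" "p = 2 \<Longrightarrow> b > 1"
  shows "\<exists>u. \<not> p dvd u \<and> (1 + p ^ b) ^ (p ^ e) = 1 + p ^ (b + e) * u"
proof (induction e)
  case 0
  show ?case using p by (intro exI[of _ 1]) auto
next
  case (Suc e)
  then obtain u where u: "\<not> p dvd u" "(1 + p ^ b) ^ (p ^ e) = 1 + p ^ (b + e) * u" by blast
  have p0: "p > 0" using p prime_gt_0_nat by simp
  define y where "y = int (p ^ (b + e) * u)"
  have "p ^ 1 dvd p ^ (b + e)" using b by (intro le_imp_power_dvd) auto
  hence "p dvd p ^ (b + e) * u" by (simp add: dvd_mult2)
  hence 1: "int p dvd y" unfolding y_def of_nat_dvd_iff .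
  have 2: "4 dvd y" if "p = 2"
  proof -
    have "(2::nat) ^ 2 dvd p ^ (b + e)" unfolding that using b(2)[OF that] by (intro le_imp_power_dvd) auto
    hence "4 dvd p ^ (b + e) * u" by (simp add: dvd_mult2)
    thus ?thesis unfolding y_def by (metis of_nat_dvd_iff of_nat_numeral)
  qed
  obtain t where t: "(\<Sum>i<p. (1 + y) ^ i) = int p * (1 + int p * t)"
    using lifting_exponent_step[OF p 1 2] by blast
  define u' where "u' = int u * (1 + int p * t)"
  have "(1 + y) ^ p - 1 = y * (\<Sum>i<p. (1 + y) ^ i)"
    using power_diff_1_eq[of "1 + y" p] by simp
  also have "\<dots> = int (p ^ (b + Suc e)) * u'" unfolding t by (simp add: y_def u'_def algebra_simps)
  finally have eq: "(1 + y) ^ p = 1 + int (p ^ (b + Suc e)) * u'" by simp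
  have "u' \<ge> 0"
  proof -
    have "(1 + y) ^ p \<ge> 1" unfolding y_def by (intro one_le_power) auto
    hence "int (p ^ (b + Suc e)) * u' \<ge> 0" using eq by simp
    moreover have "int (p ^ (b + Suc e)) > 0" using p0 by simp
    ultimately show ?thesis by (metis mult_pos_neg not_less)
  qed
  define U where "U = nat u'"
  have U: "int U = u'" using \<open>u' \<ge> 0\<close> by (simp add: U_def)
  have "\<not> int p dvd u'"
  proof
    assume "int p dvd u'"
    hence "int p dvd u' - int p * (int u * t)" by (intro dvd_diff) auto
    also have "u' - int p * (int u * t) = int u" by (simp add: u'_def algebra_simps)
    finally show False using u by simp
  qed
  hence "\<not> p dvd U" using U by (metis of_nat_dvd_iff)
  moreover have "int ((1 + p ^ b) ^ (p ^ Suc e)) = int (1 + p ^ (b + Suc e) * U)"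
  proof -
    have "(1 + p ^ b) ^ (p ^ Suc e) = ((1 + p ^ b) ^ (p ^ e)) ^ p"
      by (simp add: mult.commute flip: power_mult)
    also have "\<dots> = (1 + p ^ (b + e) * u) ^ p" by (simp only: u(2))
    also have "int \<dots> = (1 + y) ^ p" by (simp add: y_def)
    finally show ?thesis unfolding eq U[symmetric] by simp
  qed
  hence "(1 + p ^ b) ^ (p ^ Suc e) = 1 + p ^ (b + Suc e) * U" by (simp only: of_nat_eq_iff)
  ultimately show ?case by blast
qed

text \<open>Digit by digit: by \<open>lifting_exponent\<close>, multiplying by a power of
  \<open>s ^ (p ^ e) = 1 + p ^ (b + e) * u\<close> leaves the residue modulo
  \<open>p ^ (b + e)\<close> alone and can set the next base-\<open>p\<close> digit to any value, as
  \<open>u\<close> is a unit modulo \<open>p\<close>.\<close>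

lemma one_plus_prime_power_generates:
  fixes p b e n :: nat
  assumes p: "prime p" and b: "b > 0" "p = 2 \<Longrightarrow> b > 1"
  shows "\<exists>i. [(1 + p ^ b) ^ i = 1 + p ^ b * n] (mod p ^ (b + e))"
proof (induction e)
  case 0
  show ?case using cong_sym[OF cong_one_plus_mult[of "p ^ b" n]] by (intro exI[of _ 0]) simp
next
  case (Suc e)
  define s where "s = 1 + p ^ b"
  obtain i where i: "[s ^ i = 1 + p ^ b * n] (mod p ^ (b + e))"
    using Suc.IH by (auto simp: s_def)
  obtain u where u: "\<not> p dvd u" "s ^ (p ^ e) = 1 + p ^ (b + e) * u"
    using lifting_exponent[OF p b, of e] by (auto simp: s_def)
  define P where "P = int (p ^ (b + e))"
  have "[int (s ^ i) = int (1 + p ^ b * n)] (mod P)" using i unfolding P_def by (simp only: cong_int_iff)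
  then obtain q where q: "int (s ^ i) - int (1 + p ^ b * n) = P * q"
    unfolding cong_iff_dvd_diff by blast
  have "coprime u p" using u p by (metis coprime_commute prime_imp_coprime)
  hence "coprime (int u) (int p)" by simp
  then obtain r0 where r0: "[int u * r0 = 1] (mod int p)" using cong_solve_coprime_int by blast
  \<comment> \<open>Chosen so that \<open>q + u * r\<close> vanishes modulo \<open>p\<close>;
    \<open>r0\<close> is the inverse of \<open>u\<close>.\<close>
  define r where "r = nat ((- q * r0) mod int p)"
  have p0: "p > 0" using p prime_gt_0_nat by simp
  have "int r = (- q * r0) mod int p" using p0 by (simp add: r_def)
  hence "[int r = - q * r0] (mod int p)" by (simp add: cong_def)
  hence "[int u * int r = int u * (- q * r0)] (mod int p)" by (intro cong_mult) auto
  also have "int u * (- q * r0) = (- q) * (int u * r0)" by simp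
  also have "[(- q) * (int u * r0) = (- q) * 1] (mod int p)" by (intro cong_mult r0) auto
  finally have "[q + int u * int r = q + (- q) * 1] (mod int p)" by (intro cong_add) auto
  hence "int p dvd q + int u * int r" by (simp add: cong_0_iff)
  then obtain k where k: "q + int u * int r = int p * k" by blast
  have "p ^ 1 dvd p ^ b" using b by (intro le_imp_power_dvd) auto
  hence "p dvd p ^ b" by simp
  hence "int p dvd int (p ^ b)" by (simp only: of_nat_dvd_iff)
  have "[int s = 1] (mod int p)" unfolding s_def using \<open>int p dvd int (p ^ b)\<close>
    by (simp add: cong_iff_dvd_diff)
  hence "[int s ^ i = 1 ^ i] (mod int p)" by (rule cong_pow)
  then obtain k1 where k1: "int s ^ i = 1 + int p * k1" by (metis cong_iff_dvd_diff dvdE add.commute diff_add_cancel power_one)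
  have "\<exists>t. (1 + P * int u) ^ r = 1 + P * int u * int r + P ^ 2 * t"
  proof (induction r)
    case (Suc r)
    then obtain t where "(1 + P * int u) ^ r = 1 + P * int u * int r + P ^ 2 * t" by blast
    hence "(1 + P * int u) ^ Suc r = 1 + P * int u * int (Suc r) + P ^ 2 * (int u ^ 2 * int r + t + P * int u * t)"
      by (simp add: algebra_simps power2_eq_square)
    thus ?case by blast
  qed (intro exI[of _ 0], simp)
  then obtain t where t: "(1 + P * int u) ^ r = 1 + P * int u * int r + P ^ 2 * t" by blast
  have "p ^ 1 dvd p ^ (b + e)" using b by (intro le_imp_power_dvd) auto
  hence "p dvd p ^ (b + e)" by simp
  hence "int p dvd P" unfolding P_def by (simp only: of_nat_dvd_iff)
  then obtain P' where P': "P = int p * P'" by blast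
  have "int (s ^ (i + p ^ e * r)) = int s ^ i * (1 + P * int u) ^ r"
  proof -
    have "s ^ (i + p ^ e * r) = s ^ i * (s ^ (p ^ e)) ^ r" by (simp add: power_add power_mult)
    thus ?thesis unfolding u(2) by (simp add: P_def)
  qed
  also have "\<dots> = int s ^ i + P * int s ^ i * (int u * int r) + P ^ 2 * (int s ^ i * t)"
    unfolding t by (simp add: algebra_simps)
  also have "P * int s ^ i * (int u * int r) = P * (int u * int r) + P * int p * (k1 * int u * int r)"
    unfolding k1 by (simp add: algebra_simps)
  also have "P ^ 2 * (int s ^ i * t) = P * int p * (P' * int s ^ i * t)"
    by (subst power2_eq_square, subst (2) P') simp
  also have "int s ^ i = int (1 + p ^ b * n) + P * q" using q by simp
  finally have "int (s ^ (i + p ^ e * r)) - int (1 + p ^ b * n) =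
      P * (q + int u * int r) + P * int p * (k1 * int u * int r) + P * int p * (P' * (int (1 + p ^ b * n) + P * q) * t)"
    by (simp add: algebra_simps)
  hence "P * int p dvd int (s ^ (i + p ^ e * r)) - int (1 + p ^ b * n)"
    unfolding k by simp
  also have "P * int p = int (p ^ (b + Suc e))" by (simp add: P_def)
  finally have "[int (s ^ (i + p ^ e * r)) = int (1 + p ^ b * n)] (mod int (p ^ (b + Suc e)))"
    by (simp only: cong_iff_dvd_diff)
  thus ?case unfolding cong_int_iff s_def by blast
qed

section \<open>Galois action on the Fourier coefficients\<close>

locale butson_seq = prime_power_seq +
  fixes b m :: nat
  assumes b: "b \<le> a" and m: "\<not> p dvd m" "m > 0" and root: "c x ^ (m * p ^ b) = 1"
begin

lemma p_pos: "p > 0"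
  using p prime_gt_0_nat by simp

lemma not_dvd_coprime: "\<not> p dvd n \<longleftrightarrow> coprime n p"
  using p by (metis coprime_commute prime_imp_coprime coprime_absorb_left not_prime_unit)

text \<open>All \<open>X k\<close> are put into one ring Z[z]. Its order \<open>N\<close> is left
  free so that further roots of unity can be adjoined. An exponent that is 1 modulo
  \<open>m * p ^ b\<close> fixes every \<open>c x\<close>, so on the coefficients it only permutes
  the frequencies.\<close>

lemma polynomial_representation:
  assumes "N > 0" "m * p ^ a dvd N"
  obtains z F where "proot N z" "w = z ^ (N div p ^ a)" "\<And>k. ieval (F k) z = X k"
    "\<And>s k. [s = 1] (mod m * p ^ b) \<Longrightarrow> ieval (F k) (z ^ s) = X (s * k)"
proof -
  obtain M where M: "N = M * p ^ a" "m dvd M"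
    using assms p_pos by (auto elim!: dvdE simp: mult_ac)
  have "M > 0" using assms M by auto
  define z where "z = cis (2 * pi / real N)"
  have z: "proot N z" unfolding z_def by (rule proot_cis[OF assms(1)])
  have NM: "N div p ^ a = M" using p_pos by (simp add: M)
  have w: "w = z ^ M"
    unfolding w_def z_def DeMoivre using \<open>M > 0\<close> by (simp add: M)
  have "m * p ^ b dvd N"
  proof -
    have "m * p ^ b dvd M * p ^ a" by (intro mult_dvd_mono M le_imp_power_dvd b)
    thus ?thesis by (simp add: M)
  qed
  have "\<exists>e. c x = z ^ e" for x
  proof -
    obtain k where "N = m * p ^ b * k" using \<open>m * p ^ b dvd N\<close> by blast
    hence "c x ^ N = 1" using root[of x] by (simp add: power_mult)
    thus ?thesis using root_of_unity_eq_power[OF z] by metis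
  qed
  then obtain e where e: "\<And>x. c x = z ^ e x" by metis
  define F where "F k = (\<Sum>x<p ^ a. monom (1 :: int) (e x + M * (k * x)))" for k
  have 1: "ieval (F k) z = X k" for k
    by (simp add: F_def ieval_sum X_def e w power_add power_mult)
  have 2: "ieval (F k) (z ^ s) = X (s * k)" if "[s = 1] (mod m * p ^ b)" for s k
  proof -
    have "(z ^ s) ^ (e x + M * (k * x)) = c x * w ^ (s * k * x)" for x
    proof -
      have "(z ^ s) ^ (e x + M * (k * x)) = c x ^ s * w ^ (s * k * x)"
        unfolding e w by (simp add: power_add algebra_simps flip: power_mult)
      also have "c x ^ s = c x ^ 1" by (rule root_power_cong[OF root that])
      finally show ?thesis by simp
    qed
    thus ?thesis by (simp add: F_def ieval_sum X_def)
  qed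
  show ?thesis using that[OF z _ 1 2] by (simp add: NM w)
qed

text \<open>The Chinese remainder theorem supplies a conjugation that fixes \<open>e\<close> and all
  \<open>c x\<close> but acts on \<open>w\<close> by the exponent \<open>s\<close>; it is applied to
  the given relation.\<close>

lemma galois_transport:
  assumes e: "X k = e * w ^ j * X l" "e ^ A = 1" "\<not> p dvd A" "A > 0"
    and s: "[s = 1] (mod p ^ b)" "coprime s p"
  shows "X (s * k) = e * w ^ (s * j) * X (s * l)"
proof -
  define N where "N = m * A * p ^ a"
  have N: "N > 0" "m * p ^ a dvd N" using m e p_pos by (auto simp: N_def)
  obtain z F where z: "proot N z" and wz: "w = z ^ (N div p ^ a)" and F: "\<And>k. ieval (F k) z = X k"
    "\<And>s k. [s = 1] (mod m * p ^ b) \<Longrightarrow> ieval (F k) (z ^ s) = X (s * k)"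
    using polynomial_representation[OF N] by metis
  have Nd: "N div p ^ a = m * A" using p_pos by (simp add: N_def)
  have "N = A * (m * p ^ a)" by (simp add: N_def)
  hence "e ^ N = 1" using e(2) by (simp add: power_mult)
  then obtain e0 where e0: "e = z ^ e0" using root_of_unity_eq_power[OF z] by blast
  have cop: "coprime (m * A) (p ^ a)" using m e not_dvd_coprime by simp
  obtain s' where s': "[s' = 1] (mod m * A)" "[s' = s] (mod p ^ a)"
    using binary_chinese_remainder_nat[OF cop] by blast
  have s'm: "[s' = 1] (mod m)" "[s' = 1] (mod A)"
    by (rule cong_dvd_modulus_nat[OF s'(1)]; simp)+
  have "[s' = s] (mod p ^ b)" using s'(2) b by (meson cong_dvd_modulus_nat le_imp_power_dvd)
  hence "[s' = 1] (mod p ^ b)" using s(1) cong_trans by blast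
  hence s'1: "[s' = 1] (mod m * p ^ b)"
    using s'm m not_dvd_coprime by (intro coprime_cong_mult_nat) auto
  have "coprime s' (m * A)" using s'(1) by (metis cong_imp_coprime cong_sym coprime_1_left)
  moreover have "coprime s' (p ^ a)"
    using s'(2) s(2) by (metis cong_imp_coprime cong_sym coprime_power_right_iff)
  ultimately have s'N: "coprime s' N" by (simp add: N_def)
  have "ieval (F k - monom 1 (e0 + m * A * j) * F l) z = 0"
    using e(1) F(1) by (simp add: e0 wz Nd power_add power_mult)
  hence "ieval (F k - monom 1 (e0 + m * A * j) * F l) (z ^ s') = 0"
    by (rule ieval_power_coprime_eq_0[OF z s'N])
  hence "X (s' * k) = (z ^ s') ^ (e0 + m * A * j) * X (s' * l)"
    using F(2)[OF s'1] by simp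
  also have "(z ^ s') ^ (e0 + m * A * j) = e ^ s' * w ^ (s' * j)"
    unfolding e0 wz Nd by (simp add: power_add algebra_simps flip: power_mult)
  also have "e ^ s' = e ^ 1" by (rule root_power_cong[OF e(2) s'm(2)])
  also have "w ^ (s' * j) = w ^ (s * j)" by (intro w_cong cong_mult s') auto
  also have "X (s' * k) = X (s * k)" by (intro X_cong cong_mult s') auto
  also have "X (s' * l) = X (s * l)" by (intro X_cong cong_mult s') auto
  finally show ?thesis by simp
qed

text \<open>The unit \<open>u\<close> obtained first has an unknown order \<open>M\<close>. In a
  second ring that contains \<open>u\<close>, its order is shown to divide
  \<open>m * M' * p ^ a\<close> with \<open>M'\<close> prime to \<open>p\<close>, so its
  \<open>p\<close>-part is already a power of \<open>w\<close>.\<close>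

lemma galois_conj_X:
  assumes s: "[s = 1] (mod p ^ b)" "coprime s p"
  obtains e A j where "X (s * k) = e * w ^ j * X k" "e ^ A = 1" "\<not> p dvd A" "A > 0"
proof -
  have cop: "coprime m (p ^ a)" using m not_dvd_coprime by simp
  define N where "N = m * p ^ a"
  have N: "N > 0" "m * p ^ a dvd N" using m p_pos by (auto simp: N_def)
  obtain z F where z: "proot N z" and F: "\<And>k. ieval (F k) z = X k"
    "\<And>s k. [s = 1] (mod m * p ^ b) \<Longrightarrow> ieval (F k) (z ^ s) = X (s * k)"
    using polynomial_representation[OF N] by metis
  obtain s' where s': "[s' = 1] (mod m)" "[s' = s] (mod p ^ a)"
    using binary_chinese_remainder_nat[OF cop] by blast
  have "[s' = s] (mod p ^ b)" using s'(2) b by (meson cong_dvd_modulus_nat le_imp_power_dvd)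
  hence "[s' = 1] (mod p ^ b)" using s(1) cong_trans by blast
  hence s'1: "[s' = 1] (mod m * p ^ b)"
    using s' m not_dvd_coprime by (intro coprime_cong_mult_nat) auto
  have "[s = s'] (mod p)" using s'(2) a by (intro cong_sym[OF cong_dvd_modulus_nat[OF s'(2)]]) auto
  hence s'p: "coprime s' p" using s(2) cong_imp_coprime by blast
  hence "s' > 0" using p by (cases "s' = 0") auto
  hence "m dvd s' - 1" using s'(1) by (metis One_nat_def Suc_leI cong_sym_eq cong_altdef_nat)
  then obtain i where "s' - 1 = m * i" by blast
  hence i: "s' = 1 + m * i" using \<open>s' > 0\<close> by simp
  interpret C: prime_cyclotomic p a m z
    by unfold_locales (use p a m z in \<open>auto simp: N_def\<close>)
  obtain u M where u: "M > 0" "u ^ M = 1" "ieval (F k) (z ^ s') = u * ieval (F k) z"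
    using C.galois_conj_root_of_unity[OF s'p i, of "F k" a] X_norm F(1) by metis
  have "X (s' * k) = X (s * k)" by (intro X_cong cong_mult s') auto
  hence Xu: "X (s * k) = u * X k" using u(3) F(1) F(2)[OF s'1] by simp
  obtain r M' where M: "M = p ^ r * M'" "\<not> p dvd M'"
    using u(1) p by (metis multiplicity_decompose' not_prime_unit not_gr0)
  have "M' > 0" using u(1) M by (cases "M' = 0") auto
  define N2 where "N2 = m * M * p ^ a"
  have N2: "N2 > 0" "m * p ^ a dvd N2" using u m p_pos by (auto simp: N2_def)
  obtain z2 F2 where z2: "proot N2 z2" and F2: "\<And>k. ieval (F2 k) z2 = X k"
    "\<And>s k. [s = 1] (mod m * p ^ b) \<Longrightarrow> ieval (F2 k) (z2 ^ s) = X (s * k)"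
    using polynomial_representation[OF N2] by metis
  have "N2 = M * (m * p ^ a)" by (simp add: N2_def)
  hence "u ^ N2 = 1" using u(2) by (simp add: power_mult)
  then obtain e where e: "u = z2 ^ e" using root_of_unity_eq_power[OF z2] by blast
  define L where "L = m * M' * p ^ a"
  define s2 where "s2 = 1 + L"
  \<comment> \<open>\<open>u\<close> is fixed by every conjugation that fixes \<open>c\<close> and \<open>w\<close>, which bounds its order.\<close>
  have s2L: "coprime s2 L" unfolding s2_def by simp
  hence "coprime s2 p" using a by (simp add: L_def)
  hence s2N: "coprime s2 N2" using s2L by (simp add: L_def N2_def M)
  have "m * p ^ b dvd L"
  proof -
    have "m * p ^ b dvd (m * M') * p ^ a" by (intro mult_dvd_mono le_imp_power_dvd b) auto
    thus ?thesis by (simp add: L_def)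
  qed
  hence s2c: "[s2 = 1] (mod m * p ^ b)" unfolding s2_def by (auto elim!: dvdE simp only: cong_one_plus_mult)
  have s2a: "[s2 = 1] (mod p ^ a)" using cong_one_plus_mult[of "p ^ a" "m * M'"] by (simp add: s2_def L_def mult_ac)
  have "ieval (F2 (s * k) - monom 1 e * F2 k) z2 = 0" using Xu F2(1) by (simp add: e)
  hence "ieval (F2 (s * k) - monom 1 e * F2 k) (z2 ^ s2) = 0"
    by (rule ieval_power_coprime_eq_0[OF z2 s2N])
  hence "X (s2 * (s * k)) = (z2 ^ s2) ^ e * X (s2 * k)" using F2(2)[OF s2c] by simp
  moreover have "[s2 * (s * k) = 1 * (s * k)] (mod p ^ a)" "[s2 * k = 1 * k] (mod p ^ a)"
    by (intro cong_mult s2a; simp)+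
  hence "X (s2 * (s * k)) = X (s * k)" "X (s2 * k) = X k"
    by (metis X_cong mult_1)+
  moreover have "(z2 ^ s2) ^ e = u ^ s2" by (simp add: e mult.commute flip: power_mult)
  ultimately have "u * X k = u ^ s2 * X k" using Xu by metis
  hence "u = u * u ^ L" using X_nonzero[of k] by (simp add: s2_def)
  moreover have "u \<noteq> 0" using u by (auto simp: power_0_left)
  ultimately have uL: "u ^ (m * M' * p ^ a) = 1" by (simp add: L_def)
  have A: "\<not> p dvd m * M'" using p m M by (simp add: prime_dvd_mult_iff)
  hence "coprime (m * M') (p ^ a)" using not_dvd_coprime by simp
  then obtain x y where xy: "u = x * y" "x ^ (m * M') = 1" "y ^ (p ^ a) = 1"
    using root_of_unity_split[OF uL] by blast
  obtain j where "y = w ^ j" using root_of_unity_eq_power[OF w xy(3)] by blast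
  thus ?thesis using that[of x j "m * M'"] xy A Xu m \<open>M' > 0\<close> by simp
qed

text \<open>Transporting the relation by \<open>s ^ n\<close> multiplies the exponent of
  \<open>w\<close> by \<open>s ^ n\<close> and keeps \<open>e\<close>; the exponents therefore add
  up to a geometric sum.\<close>

lemma galois_conj_X_power:
  assumes e: "X (s * k) = e * w ^ j * X k" "e ^ A = 1" "\<not> p dvd A" "A > 0"
    and s: "[s = 1] (mod p ^ b)" "coprime s p"
  shows "X (s ^ n * k) = e ^ n * w ^ (j * (\<Sum>i<n. s ^ i)) * X k"
proof (induction n)
  case (Suc n)
  have "[s ^ n = 1 ^ n] (mod p ^ b)" by (rule cong_pow[OF s(1)])
  hence "X (s ^ n * (s * k)) = e * w ^ (s ^ n * j) * X (s ^ n * k)"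
    using s by (intro galois_transport[OF e]) auto
  also note Suc.IH
  finally show ?case by (simp add: algebra_simps power_add)
qed simp

text \<open>After \<open>d = p ^ (a - b)\<close> steps the orbit of \<open>k\<close> under
  \<open>s = 1 + p ^ b\<close> closes, so \<open>e ^ d * w ^ (j * S d) = 1\<close>. The order of
  \<open>e\<close> is prime to \<open>p\<close>, hence \<open>e = 1\<close>; and \<open>S d\<close>
  is \<open>d\<close> times a unit modulo \<open>p\<close>, hence \<open>p ^ b\<close> divides
  \<open>j\<close>. Since \<open>s\<close> generates, the whole class of \<open>k\<close> is
  reached.\<close>

lemma ex_orbit_phase:
  assumes b0: "b > 0" "p = 2 \<Longrightarrow> b > 1" and k: "coprime k p"
  obtains g where "\<And>n. X (k + p ^ b * n) = w ^ (g * p ^ b * n) * X k"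
proof -
  define s where "s = 1 + p ^ b"
  have sb: "[s = 1] (mod p ^ b)" using cong_one_plus_mult[of "p ^ b" 1] by (simp add: s_def)
  have sp: "coprime s p"
  proof -
    have "coprime s (p ^ b)"
      using coprime_Suc_left_nat[of "p ^ b"] by (simp add: s_def del: coprime_power_right_iff)
    thus ?thesis using b0 by simp
  qed
  obtain e A j where e: "X (s * k) = e * w ^ j * X k" "e ^ A = 1" "\<not> p dvd A" "A > 0"
    using galois_conj_X[OF sb sp] by metis
  note iter = galois_conj_X_power[OF e sb sp]
  define S where "S n = (\<Sum>i<n. s ^ i)" for n
  have S: "1 + p ^ b * S n = s ^ n" for n
    unfolding S_def by (induction n) (auto simp: s_def algebra_simps)
  define d where "d = p ^ (a - b)"
  have pd: "p ^ a = p ^ b * d" using b by (simp add: d_def flip: power_add)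
  obtain u where u: "\<not> p dvd u" "s ^ d = 1 + p ^ a * u"
    using lifting_exponent[OF p b0, of "a - b"] b by (auto simp: s_def d_def)
  have Sd: "S d = d * u"
  proof -
    have "1 + p ^ b * S d = 1 + p ^ b * (d * u)" using S[of d, unfolded u(2) pd] by (simp only: mult.assoc)
    thus ?thesis using p_pos by simp
  qed
  have "[s ^ d * k = 1 * k] (mod p ^ a)"
    unfolding u(2) by (intro cong_mult cong_one_plus_mult) auto
  hence "X (s ^ d * k) = X k" using X_cong by (metis mult_1)
  hence one: "e ^ d * w ^ (j * S d) = 1"
    using iter[of d] X_nonzero[of k] by (simp add: S_def)
  have e1: "e = 1"
  proof (rule root_of_unity_coprime_orders[of e A "d * p ^ a", OF e(2)])
    have "(w ^ (j * S d)) ^ (p ^ a) = (w ^ (p ^ a)) ^ (j * S d)"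
      by (metis power_mult mult.commute)
    hence "(e ^ d * w ^ (j * S d)) ^ (p ^ a) = e ^ (d * p ^ a)"
      by (simp add: power_mult_distrib power_mult)
    thus "e ^ (d * p ^ a) = 1" unfolding one by simp
    show "coprime A (d * p ^ a)" using e(3) not_dvd_coprime by (simp add: d_def)
  qed
  hence "p ^ a dvd j * S d" using one proot_power_eq_1_iff[OF w] by simp
  hence "p ^ b * d dvd (j * u) * d" by (simp add: Sd pd mult_ac)
  moreover have "d > 0" using p_pos by (simp add: d_def)
  ultimately have "p ^ b dvd j * u" by simp
  moreover have "coprime (p ^ b) u" using u not_dvd_coprime by (simp add: coprime_commute)
  ultimately have "p ^ b dvd j" by (simp add: coprime_dvd_mult_left_iff)
  then obtain g0 where g0: "j = p ^ b * g0" by blast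
  have orbit: "X ((1 + p ^ b * n) * k) = w ^ (g0 * p ^ b * n) * X k" for n
  proof -
    obtain i where i: "[s ^ i = 1 + p ^ b * n] (mod p ^ a)"
      using one_plus_prime_power_generates[OF p b0, of n "a - b"] b by (auto simp: s_def)
    have "X ((1 + p ^ b * n) * k) = X (s ^ i * k)"
      by (intro X_cong cong_mult cong_sym[OF i]) auto
    also have "\<dots> = w ^ (g0 * (p ^ b * S i)) * X k"
      using iter[of i] by (simp add: e1 S_def g0 mult_ac)
    also have "w ^ (g0 * (p ^ b * S i)) = w ^ (g0 * (p ^ b * n))"
    proof (rule w_cong)
      have "[1 + p ^ b * S i = 1 + p ^ b * n] (mod p ^ a)" using i S by simp
      hence "[p ^ b * S i = p ^ b * n] (mod p ^ a)" by (simp only: cong_add_lcancel_nat)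
      thus "[g0 * (p ^ b * S i) = g0 * (p ^ b * n)] (mod p ^ a)" by (rule cong_scalar_left)
    qed
    finally show ?thesis by (simp add: mult_ac)
  qed
  \<comment> \<open>Replacing \<open>n\<close> by \<open>k' * n\<close> turns the multiplicative
    orbit \<open>(1 + p ^ b * n) * k\<close> into the translates
    \<open>k + p ^ b * n\<close>.\<close>
  have "coprime k (p ^ a)" using k by simp
  then obtain k' where k': "[k * k' = 1] (mod p ^ a)" by (metis One_nat_def cong_solve_coprime_nat)
  show ?thesis
  proof (rule that[of "g0 * k'"])
    fix n
    have "[k * k' * (p ^ b * n) = 1 * (p ^ b * n)] (mod p ^ a)" by (intro cong_mult k') auto
    hence "[k + k * k' * (p ^ b * n) = k + 1 * (p ^ b * n)] (mod p ^ a)" by (intro cong_add) auto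
    hence "X (k + p ^ b * n) = X (k + k * k' * (p ^ b * n))" using X_cong by (metis mult_1)
    also have "k + k * k' * (p ^ b * n) = (1 + p ^ b * (k' * n)) * k" by (simp add: algebra_simps)
    also have "X \<dots> = w ^ (g0 * p ^ b * (k' * n)) * X k" by (rule orbit)
    finally show "X (k + p ^ b * n) = w ^ (g0 * k' * p ^ b * n) * X k" by (simp add: mult_ac)
  qed
qed

lemma card_coprime_below: "b > 0 \<Longrightarrow> card {r. r < p ^ b \<and> coprime r p} = p ^ b - p ^ (b - 1)"
proof -
  assume b0: "b > 0"
  have "{r. r < p ^ b \<and> coprime r p} = totatives (p ^ b)"
  proof (rule equalityI; rule subsetI)
    fix r assume "r \<in> {r. r < p ^ b \<and> coprime r p}"
    moreover have "r > 0" using calculation p by (cases "r = 0") auto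
    ultimately show "r \<in> totatives (p ^ b)" by (auto simp: totatives_def)
  next
    fix r assume r: "r \<in> totatives (p ^ b)"
    moreover have "r \<noteq> p ^ b" using r b0 p by (auto simp: totatives_def)
    ultimately show "r \<in> {r. r < p ^ b \<and> coprime r p}" using b0 by (auto simp: totatives_def)
  qed
  hence "card {r. r < p ^ b \<and> coprime r p} = totient (p ^ b)" by (simp add: totient_def)
  also have "\<dots> = p ^ b - p ^ (b - 1)"
    using totient_prime_power[OF p b0] power_minus_mult[OF b0, of p] by (simp add: right_diff_distrib')
  finally show ?thesis .
qed

text \<open>Each unit class modulo \<open>p ^ b\<close> allows \<open>c\<close> to differ from
  \<open>avg\<close> on one residue class modulo \<open>p ^ (a - b)\<close>, hence at no more than
  \<open>p ^ b\<close> places. The energy bound compares the total with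
  \<open>p ^ a - p ^ (a - 1)\<close>.\<close>

lemma exponent_le:
  assumes b0: "b > 0" "p = 2 \<Longrightarrow> b > 1"
  shows "a \<le> 2 * b"
proof (rule ccontr)
  assume "\<not> a \<le> 2 * b"
  hence a2: "2 * b + 1 \<le> a" by simp
  have "\<exists>g. \<forall>n. X (r + p ^ b * n) = w ^ (g * p ^ b * n) * X r" if "coprime r p" for r
    using ex_orbit_phase[OF b0 that] by metis
  then obtain g where g: "\<And>r n. coprime r p \<Longrightarrow> X (r + p ^ b * n) = w ^ (g r * p ^ b * n) * X r"
    by metis
  define T where "T = {r. r < p ^ b \<and> coprime r p}"
  define C where "C r = {x. x < p ^ (a - b) * p ^ b \<and> [x = g r] (mod p ^ (a - b))}" for r
  have pa': "p ^ (a - b) * p ^ b = p ^ a" using b by (simp flip: power_add)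
  have "finite T" by (simp add: T_def)
  have "p ^ a \<le> card (\<Union>r\<in>T. C r) + p ^ (a - 1)"
  proof (rule card_support_ge)
    show "(\<Union>r\<in>T. C r) \<subseteq> {..<p ^ a}" by (auto simp: C_def pa')
    fix x assume x: "x < p ^ a" "x \<notin> (\<Union>r\<in>T. C r)"
    show "c x = avg x"
    proof (rule eq_avg[OF b0(1) b])
      show "X (r + p ^ b * n) = w ^ (g r * p ^ b * n) * X r" if "coprime r p" for r n
        using g that by blast
      show "\<not> [x = g r] (mod p ^ (a - b))" if "r < p ^ b" "coprime r p" for r
        using x that by (auto simp: C_def T_def pa')
    qed
  qed
  also have "card (\<Union>r\<in>T. C r) \<le> (\<Sum>r\<in>T. card (C r))" by (rule card_UN_le[OF \<open>finite T\<close>])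
  also have "\<dots> \<le> (\<Sum>r\<in>T. p ^ b)"
    unfolding C_def using p_pos by (intro sum_mono card_residue_class_le) auto
  also have "\<dots> = (p ^ b - p ^ (b - 1)) * p ^ b"
    using card_coprime_below[OF b0(1)] by (simp add: T_def)
  finally have le: "p ^ a \<le> (p ^ b - p ^ (b - 1)) * p ^ b + p ^ (a - 1)" by simp
  define P where "P = p ^ (b - 1)"
  have Pb: "p ^ b = p * P" using b0 by (simp add: P_def power_eq_if)
  have p1: "p > 1" using p prime_gt_1_nat by blast
  obtain h where h: "p = Suc h" "h > 0" using p1 by (cases p) auto
  have P0: "P > 0" using p_pos by (simp add: P_def)
  have "p ^ a = p ^ (a - 1) + h * p ^ (a - 1)" unfolding pa by (simp add: h)
  hence "h * p ^ (a - 1) \<le> (p ^ b - p ^ (b - 1)) * p ^ b" using le by simp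
  also have "(p ^ b - p ^ (b - 1)) * p ^ b = h * (P * (p * P))"
    unfolding Pb P_def[symmetric] by (simp add: h)
  finally have "p ^ (a - 1) \<le> P * (p * P)" using h by simp
  moreover have "p ^ (2 * b) \<le> p ^ (a - 1)" using a2 p_pos by (intro power_increasing) auto
  moreover have "p ^ (2 * b) = p * (P * (p * P))"
    by (simp add: mult_2 power_add Pb)
  ultimately have "p * (P * (p * P)) \<le> P * (p * P)" by linarith
  thus False using p1 P0 by simp
qed

end

section \<open>Exceptional exponents: b = 0, and b = 1 for p = 2\<close>

lemma unit_complex_eqI:
  assumes "cmod z = 1" "Re z = - 1"
  shows "z = - 1"
  using assms by (auto simp: cmod_def complex_eq_iff power2_eq_square)

context prime_power_seq
begin

text \<open>\<open>b0\<close> is an exponent for which every unit \<open>r\<close> gives a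
  conjugation fixing \<open>c\<close>, while \<open>b\<close> is large enough for
  \<open>1 + p ^ b\<close> to generate. Conjugating the phase relation at frequency 1 by
  \<open>r\<close> yields the relation at \<open>r\<close> with the same \<open>g\<close>, so a
  single residue class carries all exceptions.\<close>

lemma shared_phase_support:
  assumes b0: "butson_seq p a c b0 m" "\<And>r. coprime r p \<Longrightarrow> [r = 1] (mod p ^ b0)"
    and b: "butson_seq p a c b m" "b > 0" "p = 2 \<Longrightarrow> b > 1"
  obtains g where "p ^ a \<le> p ^ b + p ^ (a - 1)"
    "\<And>x. \<not> [x = g] (mod p ^ (a - b)) \<Longrightarrow> c x = avg x"
proof -
  interpret B0: butson_seq p a c b0 m by fact
  interpret B: butson_seq p a c b m by fact
  have p1: "coprime 1 p" by simp
  obtain g where g: "\<And>n. X (1 + p ^ b * n) = w ^ (g * p ^ b * n) * X 1"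
    using B.ex_orbit_phase[OF b(2,3) p1] by metis
  have phase: "X (r + p ^ b * n) = w ^ (g * p ^ b * n) * X r" if r: "coprime r p" for r n
  proof -
    have "coprime r (p ^ a)" using r by simp
    then obtain r' where r': "[r * r' = 1] (mod p ^ a)" by (metis One_nat_def cong_solve_coprime_nat)
    have "X (1 + p ^ b * (r' * n)) = 1 * w ^ (g * p ^ b * (r' * n)) * X 1" using g by simp
    hence tr: "X (r * (1 + p ^ b * (r' * n))) = 1 * w ^ (r * (g * p ^ b * (r' * n))) * X (r * 1)"
      using p by (intro B0.galois_transport[where A = 1] b0 r) auto
    have "[r * r' * (p ^ b * n) = 1 * (p ^ b * n)] (mod p ^ a)" by (intro cong_mult r') auto
    hence "[r + r * r' * (p ^ b * n) = r + 1 * (p ^ b * n)] (mod p ^ a)" by (intro cong_add) auto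
    hence "X (r + p ^ b * n) = X (r + r * r' * (p ^ b * n))" using X_cong by (metis mult_1)
    also have "r + r * r' * (p ^ b * n) = r * (1 + p ^ b * (r' * n))" by (simp add: algebra_simps)
    also note tr
    also have "w ^ (r * (g * p ^ b * (r' * n))) = w ^ (g * p ^ b * n)"
    proof (rule w_cong)
      have "[r * r' * (g * p ^ b * n) = 1 * (g * p ^ b * n)] (mod p ^ a)" by (intro cong_mult r') auto
      thus "[r * (g * p ^ b * (r' * n)) = g * p ^ b * n] (mod p ^ a)" by (simp add: mult_ac)
    qed
    finally show ?thesis by simp
  qed
  have eq: "c x = avg x" if "\<not> [x = g] (mod p ^ (a - b))" for x
    by (rule eq_avg[OF b(2) B.b, where g = "\<lambda>_. g"]) (use phase that in auto)
  define S where "S = {x. x < p ^ (a - b) * p ^ b \<and> [x = g] (mod p ^ (a - b))}"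
  have pa': "p ^ (a - b) * p ^ b = p ^ a" using B.b by (simp flip: power_add)
  have "p ^ a \<le> card S + p ^ (a - 1)"
    by (rule card_support_ge) (use eq in \<open>auto simp: S_def pa'\<close>)
  moreover have "card S \<le> p ^ b" unfolding S_def using B.p_pos by (intro card_residue_class_le) auto
  ultimately have "p ^ a \<le> p ^ b + p ^ (a - 1)" by simp
  thus ?thesis using that eq by blast
qed

lemma sum_c_cnj_shift:
  assumes "\<not> p ^ a dvd l"
  shows "(\<Sum>x<p ^ a. c (x + g + l) * cnj (c (x + g))) = 0"
proof -
  have "(\<Sum>x<p ^ a. c (x + g + l) * cnj (c (x + g))) = (\<Sum>x<p ^ a. c (x + l) * cnj (c x))"
    by (rule sum_periodic_shift[of "\<lambda>x. c (x + l) * cnj (c x)"])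
      (use periodic in \<open>metis add.assoc add.commute\<close>)
  thus ?thesis using orth[OF assms] by simp
qed

lemma cmod_quotient: "cmod (c x * cnj (c y)) = 1"
  by (simp add: norm_mult norm_c)

lemma quotient_cnj: "c x * cnj (c y) * cnj (c x * cnj (c y)) = 1"
  using complex_norm_square[of "c x * cnj (c y)"] unfolding cmod_quotient by simp

lemma quotient_power: "c x ^ n = 1 \<Longrightarrow> c y ^ n = 1 \<Longrightarrow> (c x * cnj (c y)) ^ n = 1"
  by (simp add: power_mult_distrib flip: complex_cnj_power)

text \<open>\<open>b\<close> only bounds the \<open>p\<close>-part of the orders from above. Raising
  it to 1, or to 2 when \<open>p = 2\<close>, brings the generation argument into reach.\<close>

lemma butson_seq_mono:
  assumes "butson_seq p a c b m" "b \<le> b'" "b' \<le> a"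
  shows "butson_seq p a c b' m"
proof -
  interpret butson_seq p a c b m by fact
  have "c x ^ (m * p ^ b') = (c x ^ (m * p ^ b)) ^ (p ^ (b' - b))" for x
    using assms(2) by (simp add: mult.assoc flip: power_mult power_add)
  thus ?thesis using root assms(3) m by unfold_locales auto
qed

text \<open>All units modulo \<open>p\<close> act and a primitive root \<open>r\<close> generates
  them, so the unit frequencies form one orbit. Depending on \<open>e\<close>, either some entry
  equals the average, whose modulus is too small, or \<open>c\<close> is constant off one class and
  its shift-1 correlation leaves only \<open>p = 3\<close>.\<close>

lemma no_odd_seq_coprime_prime:
  assumes "butson_seq p a c 0 m" "p \<noteq> 2" "a = 1"
  shows False
proof -
  interpret B: butson_seq p a c 0 m by fact
  have p2: "p > 2" using p assms(2) prime_ge_2_nat[of p] by linarith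
  have va: "p ^ a = p" using assms by simp
  have avg_const: "avg x = avg 0" for x
  proof -
    have "(\<Sum>i<p. c (i + x)) = (\<Sum>i<p. c i)"
      by (rule sum_periodic_shift) (use periodic va in auto)
    moreover have "avg y = (\<Sum>i<p. c (i + y)) / of_nat p" for y
      by (simp only: avg_def) (simp add: assms(3) add.commute)
    ultimately show ?thesis by simp
  qed
  have norm_avg: "real p * cmod (avg 0) ^ 2 = 1"
  proof -
    have "(\<Sum>x<p. cmod (avg 0) ^ 2) = (\<Sum>x<p. cmod (avg x) ^ 2)"
      by (rule sum.cong[OF refl]) (metis avg_const)
    also have "\<dots> = real (p ^ (a - 1))" using sum_norm_avg unfolding va .
    also have "\<dots> = 1" by (simp add: assms(3))
    finally show ?thesis by simp
  qed
  obtain r where r: "residue_primroot p r"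
    using prime_primitive_root_exists[of p] p p2 by auto
  have rp: "coprime r p" using r by (simp add: residue_primroot_def coprime_commute)
  have tot: "totient p = p - 1" using p by (simp add: totient_prime)
  have "r > 0" using rp p2 by (cases "r = 0") auto
  have "\<not> p dvd r - 1"
  proof
    assume "p dvd r - 1"
    hence "[1 = r] (mod p)" using \<open>r > 0\<close> by (simp add: cong_altdef_nat cong_sym_eq)
    hence "residue_primroot p 1" using r residue_primroot_cong by blast
    thus False using residue_primroot_1_iff[of p] p2 by simp
  qed
  hence "coprime (r - 1) p" using B.not_dvd_coprime by blast
  then obtain i where i: "[(r - 1) * i = 1] (mod p)" by (metis One_nat_def cong_solve_coprime_nat)
  have r1: "[r = 1] (mod p ^ 0)" by simp
  obtain e A j where e: "X (r * 1) = e * w ^ j * X 1" "e ^ A = 1" "\<not> p dvd A" "A > 0"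
    using B.galois_conj_X[OF r1 rp] by metis
  \<comment> \<open>Solves \<open>j = j' * (r - 1)\<close> modulo \<open>p\<close>. Translating the
    sequence by \<open>j'\<close> removes the power of \<open>w\<close>, so that the conjugation
    multiplies the coefficients by \<open>e\<close> alone.\<close>
  define j' where "j' = j * i"
  have j': "[j = j' * (r - 1)] (mod p ^ a)"
  proof -
    have "[j * ((r - 1) * i) = j * 1] (mod p)" by (intro cong_mult i) auto
    thus ?thesis by (simp add: va j'_def mult_ac cong_sym_eq)
  qed
  have Xr: "w ^ j' * X (r ^ n) = e ^ n * w ^ (j' * r ^ n) * X 1" for n
  proof -
    define S where "S = (\<Sum>i<n. r ^ i)"
    have "(r - 1) * S + 1 = r ^ n" unfolding S_def
    proof (induction n)
      case (Suc n)
      have "(r - 1) * (\<Sum>i<Suc n. r ^ i) + 1 = ((r - 1) * (\<Sum>i<n. r ^ i) + 1) + (r - 1) * r ^ n"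
        by (simp add: algebra_simps)
      also have "\<dots> = r ^ n + (r - 1) * r ^ n" by (simp only: Suc.IH)
      also have "\<dots> = (1 + (r - 1)) * r ^ n" by (simp only: distrib_right mult_1)
      finally show ?case using \<open>r > 0\<close> by simp
    qed simp
    hence eq: "j' + j' * (r - 1) * S = j' * r ^ n" by (metis add.commute distrib_left mult.assoc mult.right_neutral)
    have "X (r ^ n * 1) = e ^ n * w ^ (j * S) * X 1"
      unfolding S_def by (rule B.galois_conj_X_power[OF e r1 rp])
    also have "w ^ (j * S) = w ^ (j' * (r - 1) * S)" by (intro w_cong cong_mult j') auto
    finally have "w ^ j' * X (r ^ n) = e ^ n * w ^ (j' + j' * (r - 1) * S) * X 1"
      by (simp add: power_add mult_ac)
    thus ?thesis by (simp only: eq)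
  qed
  have Xmod: "X (r ^ n mod p) = X (r ^ n)" for n by (rule X_cong) (simp add: va cong_def)
  have bij: "bij_betw (\<lambda>n. r ^ n mod p) {..<p - 1} {k. k < p ^ a \<and> coprime k p}"
  proof -
    have "{k. k < p ^ a \<and> coprime k p} = totatives p"
      using p2 by (auto simp: totatives_def va intro: Nat.gr0I le_neq_implies_less)
    thus ?thesis using residue_primroot_is_generator[OF _ r] p2 tot by simp
  qed
  have wj: "w ^ j' * cnj w ^ j' = 1" for j' by (simp add: w_cnj flip: power_mult_distrib)
  have Xr': "X (r ^ n) = cnj w ^ j' * (e ^ n * w ^ (j' * r ^ n) * X 1)" for n
    using Xr[of n] wj[of j'] by (metis mult.assoc mult.commute mult_1)
  have diff: "of_nat p * (c x - avg 0) = cnj w ^ j' * X 1 *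
     (\<Sum>n<p - 1. e ^ n * (w ^ (j' * r ^ n) * cnj w ^ (r ^ n * x)))" for x
  proof -
    have cw: "cnj w ^ (r ^ n mod p * x) = cnj w ^ (r ^ n * x)" for n
    proof -
      have "w ^ (r ^ n mod p * x) = w ^ (r ^ n * x)"
        by (intro w_cong cong_mult) (auto simp: va cong_def)
      thus ?thesis by (metis complex_cnj_power)
    qed
    have "of_nat (p ^ a) * (c x - avg x) = (\<Sum>n<p - 1. X (r ^ n mod p) * cnj w ^ (r ^ n mod p * x))"
      unfolding diff_avg by (rule sum.reindex_bij_betw[OF bij, symmetric])
    also have "\<dots> = (\<Sum>n<p - 1. cnj w ^ j' * X 1 * (e ^ n * (w ^ (j' * r ^ n) * cnj w ^ (r ^ n * x))))"
      unfolding Xmod cw by (intro sum.cong refl) (simp add: Xr' mult_ac)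
    finally show ?thesis by (simp add: va avg_const[of x] sum_distrib_left)
  qed
  show False
  proof (cases "e = 1")
    case False
    have "e ^ (p - 1) = 1"
    proof -
      have rr: "[r ^ (p - 1) = 1] (mod p ^ a)" using euler_theorem[OF rp] tot va by simp
      have "X (r ^ (p - 1)) = X 1" by (rule X_cong[OF rr])
      moreover have "w ^ (j' * r ^ (p - 1)) = w ^ (j' * 1)" by (intro w_cong cong_mult rr) auto
      moreover have "w \<noteq> 0" by (rule proot_nonzero[OF w])
      ultimately show ?thesis using Xr[of "p - 1"] X_nonzero[of 1] by simp
    qed
    \<comment> \<open>At \<open>x = j'\<close> the powers of \<open>w\<close> in \<open>diff\<close>
      cancel and exactly this sum is left.\<close>
    hence "(\<Sum>n<p - 1. e ^ n) = 0" using False by (simp add: sum_powers_root_of_unity)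
    moreover have "w ^ (j' * r ^ n) * cnj w ^ (r ^ n * j') = 1" for n
      using wj[of "j' * r ^ n"] by (simp add: mult.commute)
    ultimately have "of_nat p * (c j' - avg 0) = 0" unfolding diff by simp
    hence "c j' = avg 0" using p2 by simp
    hence "cmod (avg 0) = 1" using norm_c by metis
    thus False using norm_avg p2 by simp
  next
    case True
    define C where "C = cnj w ^ j' * X 1"
    define \<beta> where "\<beta> = avg 0 - C / of_nat p"
    \<comment> \<open>With \<open>e = 1\<close> the sum in \<open>diff\<close> runs over the
      nontrivial powers of a \<open>p\<close>-th root of unity different from 1, so it is -1
      whatever \<open>x\<close> is.\<close>
    have off: "c x = \<beta>" if "\<not> [x = j'] (mod p)" for x
    proof -
      have wk: "w ^ (j' * k) * cnj w ^ (k * x) = (w ^ j' * cnj w ^ x) ^ k" for k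
        by (simp add: power_mult_distrib mult.commute flip: power_mult)
      have "(\<Sum>n<p - 1. w ^ (j' * r ^ n) * cnj w ^ (r ^ n * x)) = (\<Sum>n<p - 1. (w ^ j' * cnj w ^ x) ^ (r ^ n mod p))"
      proof (intro sum.cong refl)
        fix n
        have "(w ^ j' * cnj w ^ x) ^ p = (w ^ p) ^ j' * (cnj w ^ p) ^ x"
          by (simp add: power_mult_distrib mult.commute flip: power_mult)
        hence "(w ^ j' * cnj w ^ x) ^ p = 1" using w_one by (simp add: va)
        hence "(w ^ j' * cnj w ^ x) ^ (r ^ n) = (w ^ j' * cnj w ^ x) ^ (r ^ n mod p)"
          by (rule root_power_cong) (simp add: cong_def)
        thus "w ^ (j' * r ^ n) * cnj w ^ (r ^ n * x) = (w ^ j' * cnj w ^ x) ^ (r ^ n mod p)"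
          by (simp only: wk)
      qed
      also have "\<dots> = (\<Sum>k | k < p ^ a \<and> coprime k p. (w ^ j' * cnj w ^ x) ^ k)"
        by (rule sum.reindex_bij_betw[OF bij])
      also have "{k. k < p ^ a \<and> coprime k p} = {..<p} - {0}"
        using p p2 by (auto simp: va intro!: prime_imp_coprime[THEN iffD1[OF coprime_commute]] dest: dvd_imp_le nat_dvd_not_less)
      also have "(\<Sum>k\<in>{..<p} - {0}. (w ^ j' * cnj w ^ x) ^ k) = (\<Sum>k<p. (w ^ j' * cnj w ^ x) ^ k) - 1"
        using p2 by (subst sum_diff1) auto
      also have "(\<Sum>k<p. (w ^ j' * cnj w ^ x) ^ k) = 0"
        using sum_w_powers[of j' x] that by (simp add: va cong_sym_eq)
      finally have "of_nat p * (c x - avg 0) = - C" using diff[of x] by (simp add: True C_def)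
      thus ?thesis using p2 by (simp add: \<beta>_def field_simps)
    qed
    have nj: "\<not> [k + j' = j'] (mod p)" if "0 < k" "k < p" for k
    proof
      assume "[k + j' = j'] (mod p)"
      hence "[k = 0] (mod p)" by (simp add: cong_add_rcancel_0_nat)
      thus False using that by (simp add: cong_0_iff nat_dvd_not_less)
    qed
    define \<delta> where "\<delta> = c j' * cnj \<beta>"
    have \<beta>: "\<beta> = c (1 + j')" using off[OF nj[of 1]] p2 by simp
    have \<delta>1: "\<delta> * cnj \<delta> = 1" unfolding \<delta>_def \<beta> by (rule quotient_cnj)
    have \<beta>1: "\<beta> * cnj \<beta> = 1" unfolding \<beta> by (rule c_cnj)
    have "\<not> p ^ a dvd 1" using p2 by (simp add: va)
    \<comment> \<open>Only the two pairs that meet \<open>j'\<close> differ from 1; they contribute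
      \<open>cnj \<delta>\<close> and \<open>\<delta>\<close>, which cannot outweigh the other
      \<open>p - 2\<close> pairs unless \<open>p\<close> is at most 4.\<close>
    hence "0 = (\<Sum>x<p. c (x + j' + 1) * cnj (c (x + j')))"
      using sum_c_cnj_shift[of 1 j'] by (simp add: va)
    also have "{..<p} = insert 0 (insert (p - 1) {1..<p - 1})" using p2 by auto
    also have "(\<Sum>x\<in>\<dots>. c (x + j' + 1) * cnj (c (x + j'))) =
      c (1 + j') * cnj (c j') + (c (p - 1 + j' + 1) * cnj (c (p - 1 + j')) +
        (\<Sum>x\<in>{1..<p - 1}. c (x + j' + 1) * cnj (c (x + j'))))"
      using p2 by simp
    also have "(\<Sum>x\<in>{1..<p - 1}. c (x + j' + 1) * cnj (c (x + j'))) = (\<Sum>x\<in>{1..<p - 1}. 1)"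
    proof (intro sum.cong refl)
      fix x assume x: "x \<in> {1..<p - 1}"
      hence x: "0 < x" "x < p" "0 < x + 1" "x + 1 < p" by auto
      have "c (x + j') = \<beta>" by (rule off[OF nj[OF x(1,2)]])
      moreover have "c (x + j' + 1) = \<beta>" using off[OF nj[OF x(3,4)]] by (simp add: add_ac)
      ultimately show "c (x + j' + 1) * cnj (c (x + j')) = 1" using \<beta>1 by simp
    qed
    also have "c (1 + j') * cnj (c j') = cnj \<delta>" by (simp add: \<delta>_def \<beta>)
    also have "c (p - 1 + j' + 1) * cnj (c (p - 1 + j')) = \<delta>"
    proof -
      have "p - 1 + j' + 1 = j' + p ^ a" using p2 by (simp add: va)
      hence "c (p - 1 + j' + 1) = c j'" using periodic by metis
      moreover have "c (p - 1 + j') = \<beta>" using off nj[of "p - 1"] p2 by simp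
      ultimately show ?thesis by (simp add: \<delta>_def)
    qed
    also have "(\<Sum>x\<in>{1..<p - 1}. 1) = (of_nat (p - 2) :: complex)" by (simp add: numeral_2_eq_2)
    finally have "\<delta> + cnj \<delta> + of_nat (p - 2) = 0" by (simp add: add_ac)
    hence sum0: "\<delta> + cnj \<delta> = - of_nat (p - 2)" by (simp only: eq_neg_iff_add_eq_0)
    hence "2 * Re \<delta> = - real (p - 2)" by (simp add: complex_eq_iff)
    moreover have "\<bar>Re \<delta>\<bar> \<le> 1" using abs_Re_le_cmod[of \<delta>] cmod_quotient[of j' "1 + j'"]
      by (simp add: \<delta>_def \<beta>)
    ultimately have "p \<le> 4" using p2 by linarith
    moreover have "p \<noteq> 4" using p by auto
    ultimately have p3: "p = 3" using p2 by linarith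
    hence "\<delta> + cnj \<delta> = - 1" using sum0 by simp
    hence "\<delta> * (\<delta> + cnj \<delta>) = - \<delta>" by simp
    hence q: "\<delta> * \<delta> + 1 = - \<delta>" using \<delta>1 by (simp add: distrib_left)
    \<comment> \<open>\<open>\<delta>\<close> is a root of \<open>x ^ 2 + x + 1\<close>, yet its
      order divides \<open>m\<close>, which is prime to 3.\<close>
    have "\<delta> ^ 3 = \<delta> * (\<delta> * \<delta> + 1) - \<delta>" by (simp add: power3_eq_cube algebra_simps)
    also have "\<dots> = - (\<delta> * \<delta> + 1) + 1 - \<delta>" unfolding q by (simp add: algebra_simps) (metis add.inverse_inverse add_diff_cancel_right' minus_add_distrib mult_minus_right q uminus_add_conv_diff)
    also have "\<dots> = 1" by (simp add: q)
    finally have "\<delta> ^ 3 = 1" .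
    moreover have "\<delta> ^ m = 1" unfolding \<delta>_def \<beta> using B.root by (intro quotient_power) simp_all
    moreover have "coprime 3 m" using B.m B.not_dvd_coprime p3 by (simp add: coprime_commute)
    ultimately have "\<delta> = 1" by (rule root_of_unity_coprime_orders)
    thus False using \<open>\<delta> + cnj \<delta> = - 1\<close> by simp
  qed
qed

text \<open>With the exponent raised to 1, the shared phase gives
  \<open>p ^ a \<le> p + p ^ (a - 1)\<close>, which leaves only period \<open>p\<close>.\<close>

lemma no_odd_seq_coprime:
  assumes B: "butson_seq p a c 0 m" and p2: "p \<noteq> 2"
  shows False
proof -
  interpret B: butson_seq p a c 0 m by fact
  have p3: "p \<ge> 3" using p p2 prime_ge_2_nat[of p] by linarith
  have B1: "butson_seq p a c 1 m" using butson_seq_mono[OF B, of 1] a by simp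
  have "p ^ a \<le> p ^ 1 + p ^ (a - 1)"
    by (rule shared_phase_support[OF B _ B1]) (use p2 in auto)
  hence le: "p * p ^ (a - 1) \<le> p + p ^ (a - 1)" using pa by simp
  have "a = 1"
  proof (rule ccontr)
    assume "a \<noteq> 1"
    hence "p ^ 1 \<le> p ^ (a - 1)" using a p3 by (intro power_increasing) auto
    hence "p \<le> p ^ (a - 1)" by simp
    moreover have "3 * p ^ (a - 1) \<le> p * p ^ (a - 1)" using p3 by simp
    ultimately show False using le p3 by linarith
  qed
  thus False using no_odd_seq_coprime_prime[OF B p2] by blast
qed

text \<open>With the exponent raised to 2, the shared phase gives
  \<open>2 ^ (a - 1) \<le> 4\<close>, so only period 8 has to be excluded by hand. There
  \<open>c\<close> has period 4 at odd offsets from \<open>g\<close>.\<close>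

lemma even_exponent_le_2:
  assumes B: "butson_seq p a c 1 m" and p2: "p = 2"
  shows "a \<le> 2"
proof (rule ccontr)
  assume "\<not> a \<le> 2"
  interpret B: butson_seq p a c 1 m by fact
  have B2: "butson_seq p a c 2 m" using butson_seq_mono[OF B, of 2] \<open>\<not> a \<le> 2\<close> by simp
  have oc: "[r = 1] (mod p ^ 1)" if "coprime r p" for r
    using that by (auto simp: p2 cong_def odd_iff_mod_2_eq_one)
  obtain g where g: "p ^ a \<le> p ^ 2 + p ^ (a - 1)" "\<And>x. \<not> [x = g] (mod p ^ (a - 2)) \<Longrightarrow> c x = avg x"
    by (rule shared_phase_support[OF B oc B2], assumption, simp, simp, rule that, assumption, blast)
  have "p ^ (a - 1) \<le> 2 ^ 2" using g(1) pa by (simp add: p2)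
  hence "a - 1 \<le> 2" unfolding p2 by (rule power_le_imp_le_exp[rotated]) simp
  hence a3: "a = 3" using \<open>\<not> a \<le> 2\<close> by linarith
  have v: "p ^ a = 8" by (simp add: p2 a3)
  have "{..<p} = {0, 1}" by (auto simp: p2)
  hence av: "avg y = (c y + c (y + 4)) / 2" for y
    by (simp only: avg_def) (simp add: p2 a3)
  have odd: "c (g + k + 4) = c (g + k)" if "odd k" for k
  proof -
    have "\<not> [g + k = g] (mod p ^ (a - 2))" using that by (simp add: p2 a3 cong_add_lcancel_0_nat cong_0_iff)
    hence "c (g + k) = (c (g + k) + c (g + k + 4)) / 2"
      using g(2)[of "g + k"] av by simp
    thus ?thesis by (simp add: field_simps)
  qed
  have c8: "c (k + 8) = c k" for k using periodic[of k] by (simp add: v)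
  have e8: "{..<8} = {0,1,2,3,4,5,6,7::nat}" by auto
  \<comment> \<open>The odd offsets contribute 4 to the shift-4 correlation, so each of the two even
    pairs must contribute its minimum -2.\<close>
  have "(\<Sum>x<8. c (x + g + 4) * cnj (c (x + g))) = 0" using sum_c_cnj_shift[of 4 g] by (simp add: v)
  hence "c (g + 4) * cnj (c g) + c (g + 1 + 4) * cnj (c (g + 1)) + c (g + 2 + 4) * cnj (c (g + 2))
     + c (g + 3 + 4) * cnj (c (g + 3)) + c (g + 8) * cnj (c (g + 4)) + c (g + 1 + 8) * cnj (c (g + 1 + 4))
     + c (g + 2 + 8) * cnj (c (g + 2 + 4)) + c (g + 3 + 8) * cnj (c (g + 3 + 4)) = 0"
    unfolding e8 by (simp add: add_ac)
  hence z4: "(c (g + 4) * cnj (c g) + c g * cnj (c (g + 4))) + (c (g + 2 + 4) * cnj (c (g + 2)) + c (g + 2) * cnj (c (g + 2 + 4))) + 4 = 0"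
    unfolding c8 using odd[of 1] odd[of 3] by (simp add: c_cnj algebra_simps)
  define d0 d2 where "d0 = c (g + 4) * cnj (c g)" and "d2 = c (g + 2 + 4) * cnj (c (g + 2))"
  have n: "cmod d0 = 1" "cmod d2 = 1" unfolding d0_def d2_def by (rule cmod_quotient)+
  have "(d0 + cnj d0) + (d2 + cnj d2) + 4 = 0" using z4 by (simp add: d0_def d2_def mult_ac)
  hence "2 * Re d0 + 2 * Re d2 = - 4" by (simp add: complex_eq_iff)
  moreover have "Re d0 \<ge> - 1" "Re d2 \<ge> - 1"
    using abs_Re_le_cmod[of d0] abs_Re_le_cmod[of d2] n by linarith+
  ultimately have "Re d0 = - 1" "Re d2 = - 1" by linarith+
  hence "d0 = - 1" "d2 = - 1" using n unit_complex_eqI by blast+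
  hence "d0 * c g = - c g" "d2 * c (g + 2) = - c (g + 2)" by simp_all
  hence even: "c (g + 4) = - c g" "c (g + 2 + 4) = - c (g + 2)"
    unfolding d0_def d2_def by (simp_all add: mult.assoc c_cnj)
  define \<alpha> \<beta> where "\<alpha> = c (g + 2) * cnj (c g)" and "\<beta> = c (g + 3) * cnj (c (g + 1))"
  have g3: "Suc (Suc (Suc g)) = g + 3" by simp
  have "(\<Sum>x<8. c (x + g + 2) * cnj (c (x + g))) = 0" using sum_c_cnj_shift[of 2 g] by (simp add: v)
  hence "c (g + 2) * cnj (c g) + c (g + 3) * cnj (c (g + 1)) + c (g + 4) * cnj (c (g + 2))
     + c (g + 1 + 4) * cnj (c (g + 3)) + c (g + 2 + 4) * cnj (c (g + 4)) + c (g + 3 + 4) * cnj (c (g + 1 + 4))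
     + c (g + 8) * cnj (c (g + 2 + 4)) + c (g + 1 + 8) * cnj (c (g + 3 + 4)) = 0"
    unfolding e8 using g3 by (simp add: add_ac)
  \<comment> \<open>The even offsets change sign after 4 steps and contribute an imaginary number,
    the odd ones a real number; both vanish separately.\<close>
  hence "2 * (\<alpha> - cnj \<alpha>) + 2 * (\<beta> + cnj \<beta>) = 0"
    unfolding c8 even using odd[of 1] odd[of 3] by (simp add: \<alpha>_def \<beta>_def algebra_simps)
  hence "Re \<beta> = 0" by (simp add: complex_eq_iff)
  hence "\<beta> + cnj \<beta> = 0" by (simp add: complex_eq_iff)
  moreover have "\<beta> * cnj \<beta> = 1" unfolding \<beta>_def by (rule quotient_cnj)
  moreover have "\<beta> * \<beta> = \<beta> * (\<beta> + cnj \<beta>) - \<beta> * cnj \<beta>" by (simp add: algebra_simps)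
  ultimately have "\<beta> ^ 2 = - 1" by (simp add: power2_eq_square)
  have "\<beta> ^ (2 * m) = 1" unfolding \<beta>_def
    using B.root[of "g + 3"] B.root[of "g + 1"] by (intro quotient_power) (simp_all add: p2 mult.commute)
  \<comment> \<open>\<open>\<beta>\<close> has order 4, which cannot divide \<open>2 * m\<close> for
    odd \<open>m\<close>.\<close>
  hence "(- 1 :: complex) ^ m = 1" using \<open>\<beta> ^ 2 = - 1\<close> by (simp add: power_mult)
  moreover have "odd m" using B.m by (simp add: p2)
  ultimately show False by simp
qed

text \<open>Orthogonality makes the quotient of the two entries purely imaginary, so it has order 4,
  whereas its order divides \<open>2 * m\<close> with \<open>m\<close> odd.\<close>

lemma no_even_seq_period_2:
  assumes B: "butson_seq p a c 1 m" and p2: "p = 2" and a1: "a = 1"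
  shows False
proof -
  interpret B: butson_seq p a c 1 m by fact
  define \<beta> where "\<beta> = c 1 * cnj (c 0)"
  have "(\<Sum>x<2. c (x + 1) * cnj (c x)) = 0" using orth[of 1] by (simp add: p2 a1)
  moreover have "c 2 = c 0" using periodic[of 0] by (simp add: p2 a1 numeral_2_eq_2)
  ultimately have "\<beta> + cnj \<beta> = 0" by (simp add: \<beta>_def numeral_2_eq_2 mult.commute)
  moreover have "\<beta> * cnj \<beta> = 1" unfolding \<beta>_def by (rule quotient_cnj)
  moreover have "\<beta> * \<beta> = \<beta> * (\<beta> + cnj \<beta>) - \<beta> * cnj \<beta>" by (simp add: algebra_simps)
  ultimately have "\<beta> ^ 2 = - 1" by (simp add: power2_eq_square)
  have "\<beta> ^ (2 * m) = 1" unfolding \<beta>_def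
    using B.root[of 1] B.root[of 0] by (intro quotient_power) (simp_all add: p2 mult.commute)
  hence "(- 1 :: complex) ^ m = 1" using \<open>\<beta> ^ 2 = - 1\<close> by (simp add: power_mult)
  moreover have "odd m" using B.m by (simp add: p2)
  ultimately show False by simp
qed

text \<open>The bounds for exponent 1 leave only period 4. There one quotient at distance 2 is minus
  the other or minus its conjugate, impossible for roots of unity of odd order.\<close>

lemma no_even_seq_coprime:
  assumes B: "butson_seq p a c 0 m" and p2: "p = 2"
  shows False
proof -
  interpret B: butson_seq p a c 0 m by fact
  have B1: "butson_seq p a c 1 m" using butson_seq_mono[OF B, of 1] a by simp
  have "a \<noteq> 1" using no_even_seq_period_2[OF B1 p2] by blast
  hence a2: "a = 2" using even_exponent_le_2[OF B1 p2] a by linarith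
  define \<alpha> \<beta> where "\<alpha> = c 2 * cnj (c 0)" and "\<beta> = c 3 * cnj (c 1)"
  have e4: "{..<4} = {0,1,2,3::nat}" by auto
  have "(\<Sum>x<4. c (x + 2) * cnj (c x)) = 0" using orth[of 2] by (simp add: p2 a2)
  moreover have "c 4 = c 0" "c 5 = c 1" using periodic[of 0] periodic[of 1] by (simp_all add: p2 a2)
  moreover have "c (Suc (Suc 0)) = c 2" "c (Suc (Suc (Suc 0))) = c 3"
    by (simp_all add: numeral_2_eq_2 numeral_3_eq_3)
  ultimately have s: "\<alpha> + \<beta> + cnj \<alpha> + cnj \<beta> = 0" unfolding e4 by (simp add: \<alpha>_def \<beta>_def mult.commute add_ac)
  have n: "\<alpha> * cnj \<alpha> = 1" "\<beta> * cnj \<beta> = 1" unfolding \<alpha>_def \<beta>_def by (rule quotient_cnj)+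
  \<comment> \<open>Two unimodular numbers with opposite real parts: this factorization gives both
    possibilities.\<close>
  have "(\<beta> + \<alpha>) * (\<beta> + cnj \<alpha>) = \<beta> * (\<alpha> + \<beta> + cnj \<alpha> + cnj \<beta>) + \<alpha> * cnj \<alpha> - \<beta> * cnj \<beta>"
    by (simp add: algebra_simps)
  hence "\<beta> = - \<alpha> \<or> \<beta> = - cnj \<alpha>" using s n by (auto simp: add_eq_0_iff2)
  moreover have am: "\<alpha> ^ m = 1" and bm: "\<beta> ^ m = 1" unfolding \<alpha>_def \<beta>_def
    using B.root by (intro quotient_power; simp)+
  moreover have "cnj \<alpha> ^ m = 1" using am by (metis complex_cnj_one complex_cnj_power)
  ultimately have "(- 1 :: complex) ^ m = 1" by (metis mult.right_neutral power_minus)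
  moreover have "odd m" using B.m by (simp add: p2)
  ultimately show False by simp
qed

theorem exponent_condition:
  assumes h: "h > 0" "\<And>x. c x ^ h = 1"
  shows "a \<le> 2 * multiplicity p h" "(p ^ a, multiplicity 2 h) \<noteq> (2, 1)"
proof -
  define b where "b = multiplicity p h"
  obtain m where m: "h = p ^ b * m" "\<not> p dvd m"
    using multiplicity_decompose'[of h p] h p unfolding b_def by (metis not_prime_unit not_gr0)
  have "m > 0" using h m by (cases "m = 0") auto
  have B: "butson_seq p a c b m" if "b \<le> a"
    using that m h \<open>m > 0\<close> by unfold_locales (auto simp: mult.commute)
  show "a \<le> 2 * multiplicity p h"
  proof (rule ccontr)
    assume "\<not> a \<le> 2 * multiplicity p h"
    \<comment> \<open>The assumed failure of the bound also provides \<open>b \<le> a\<close>, which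
      the locale demands.\<close>
    hence ab: "2 * b < a" "b \<le> a" by (simp_all add: b_def)
    interpret B: butson_seq p a c b m by (rule B[OF ab(2)])
    have Bb: "butson_seq p a c b m" by (rule B[OF ab(2)])
    consider "b = 0" "p = 2" | "b = 0" "p \<noteq> 2" | "b = 1" "p = 2" | "b > 0" "p = 2 \<Longrightarrow> b > 1"
      by linarith
    thus False
    proof cases
      case 1
      thus False using no_even_seq_coprime Bb by blast
    next
      case 2
      thus False using no_odd_seq_coprime Bb by blast
    next
      case 3
      thus False using even_exponent_le_2 Bb ab by fastforce
    next
      case 4
      thus False using B.exponent_le ab by linarith
    qed
  qed
  show "(p ^ a, multiplicity 2 h) \<noteq> (2, 1)"
  proof
    assume *: "(p ^ a, multiplicity 2 h) = (2, 1)"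
    hence "p dvd 2" using a by (metis dvd_power prod.inject)
    hence p2: "p = 2" using p primes_dvd_imp_eq two_is_prime_nat by blast
    hence "(2::nat) ^ a = 2 ^ 1" using * by simp
    hence a1: "a = 1" by (subst (asm) power_inject_exp) auto
    have "b = 1" using * p2 by (simp add: b_def)
    thus False using no_even_seq_period_2[OF _ p2 a1] B a1 by simp
  qed
qed

end

section \<open>Construction\<close>

text \<open>Writing \<open>x = i + k * j\<close> with \<open>i < k\<close>, the value is
  \<open>u j\<close> times the \<open>(i * j)\<close>-th power of a primitive
  \<open>(n * k)\<close>-th root of unity. For \<open>n = 1\<close> and constant
  \<open>u = 1\<close> these are Frank's sequences.\<close>

definition milewski :: "nat \<Rightarrow> nat \<Rightarrow> (nat \<Rightarrow> complex) \<Rightarrow> nat \<Rightarrow> complex" where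
  "milewski n k u x = u (x div k) * cis (2 * pi / real (n * k)) ^ ((x mod k) * (x div k))"

lemma milewski_periodic:
  assumes "n > 0" "k > 0" "\<And>x. u (x + n) = u x"
  shows "milewski n k u (x + n * k ^ 2) = milewski n k u x"
proof -
  define \<omega> where "\<omega> = cis (2 * pi / real (n * k))"
  have \<omega>: "proot (n * k) \<omega>" unfolding \<omega>_def using assms by (intro proot_cis) auto
  have "u (x + n * t) = u x" for x t
    by (rule periodic_cong[of u n, OF assms(3)]) (simp add: cong_def)
  moreover have "(x + n * k ^ 2) div k = x div k + n * k"
    using div_mult_self2[of k x "n * k"] assms(2) by (simp add: power2_eq_square mult_ac)
  moreover have "(x + n * k ^ 2) mod k = x mod k"
    using mod_mult_self2[of x k "n * k"] by (simp add: power2_eq_square mult_ac)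
  moreover have "\<omega> ^ (x mod k * (x div k + n * k)) = \<omega> ^ (x mod k * (x div k))"
    unfolding proot_power_eq_iff[OF \<omega>] by (simp add: cong_def distrib_left)
  ultimately show ?thesis by (simp add: milewski_def \<omega>_def)
qed

text \<open>Write \<open>l = r + k * t\<close> with \<open>r < k\<close>. If \<open>r\<close> is not
  0, then for fixed \<open>i\<close> moving \<open>j\<close> in steps of \<open>n\<close> leaves
  \<open>u\<close> unchanged and sums a nontrivial character of order dividing \<open>k\<close>. If
  \<open>r = 0\<close>, the double sum factors: the character sum vanishes when
  \<open>n dvd t\<close>, and the correlation of \<open>u\<close> vanishes otherwise.\<close>

lemma milewski_orthogonal:
  assumes nk: "n > 0" "k > 0" and u: "\<And>x. u (x + n) = u x"
    and orth: "\<And>l. \<not> n dvd l \<Longrightarrow> (\<Sum>x<n. u (x + l) * cnj (u x)) = 0"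
    and l: "\<not> n * k ^ 2 dvd l"
  shows "(\<Sum>x<n * k ^ 2. milewski n k u (x + l) * cnj (milewski n k u x)) = 0"
proof -
  define \<omega> where "\<omega> = cis (2 * pi / real (n * k))"
  have \<omega>: "proot (n * k) \<omega>" unfolding \<omega>_def using nk by (intro proot_cis) auto
  have \<omega>n: "proot k (\<omega> ^ n)" using proot_power_div[OF \<omega>] .
  have s: "milewski n k u x = u (x div k) * \<omega> ^ ((x mod k) * (x div k))" for x
    by (simp add: milewski_def \<omega>_def)
  have un: "u (x + n * t) = u x" for x t
    by (rule periodic_cong[of u n, OF u]) (simp add: cong_def)
  define r t where "r = l mod k" and "t = l div k"
  have lrt: "l = r + k * t" by (simp add: r_def t_def)
  have cnj1: "\<omega> ^ e * cnj \<omega> ^ e = 1" for e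
    using proot_norm[OF \<omega>] by (simp flip: power_mult_distrib complex_norm_square)
  have sx: "milewski n k u (i + k * j) = u j * \<omega> ^ (i * j)" if "i < k" for i j
    using that nk by (simp add: s)
  have split: "(\<Sum>x<n * k ^ 2. F x) = (\<Sum>i<k. \<Sum>j<n * k. F (i + k * j))" for F :: "nat \<Rightarrow> complex"
    using sum_nat_blocks[of F k "n * k"] by (simp add: power2_eq_square mult_ac)
  show ?thesis
  proof (cases "r = 0")
    case False
    have "(\<Sum>j<n * k. milewski n k u (i + k * j + l) * cnj (milewski n k u (i + k * j))) = 0"
      if i: "i < k" for i
    proof -
      define i' e where "i' = (i + r) mod k" and "e = (i + r) div k"
      have ir: "i + r = i' + k * e" by (simp add: i'_def e_def)
      have i'k: "i' < k" using nk by (simp add: i'_def)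
      have sl: "milewski n k u (i + k * j + l) = u (j + t + e) * \<omega> ^ (i' * (j + t + e))" for j
      proof -
        have "i + k * j + l = i' + k * (j + t + e)" using ir lrt by (simp add: algebra_simps)
        thus ?thesis using sx[OF i'k] by simp
      qed
      have ne: "\<not> [i' = i] (mod k)"
      proof
        assume "[i' = i] (mod k)"
        hence "[i + r = i + 0] (mod k)" by (simp add: i'_def cong_def)
        hence "[r = 0] (mod k)" by (simp only: cong_add_lcancel_nat)
        thus False using False nk by (simp add: cong_def r_def)
      qed
      have "(\<Sum>j<n * k. milewski n k u (i + k * j + l) * cnj (milewski n k u (i + k * j)))
         = (\<Sum>j<n. \<Sum>q<k. u (j + n * q + t + e) * \<omega> ^ (i' * (j + n * q + t + e)) * cnj (u (j + n * q) * \<omega> ^ (i * (j + n * q))))"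
        by (simp only: sl sx[OF i] sum_nat_blocks)
      also have "\<dots> = (\<Sum>j<n. u (j + t + e) * cnj (u j) * \<omega> ^ (i' * (j + t + e)) * cnj \<omega> ^ (i * j) *
          (\<Sum>q<k. ((\<omega> ^ n) ^ i' * cnj (\<omega> ^ n) ^ i) ^ q))"
        unfolding sum_distrib_left
      proof (intro sum.cong refl)
        fix j q
        have "u (j + n * q + t + e) = u (j + t + e)" using un[of "j + t + e" q] by (simp add: add_ac)
        thus "u (j + n * q + t + e) * \<omega> ^ (i' * (j + n * q + t + e)) * cnj (u (j + n * q) * \<omega> ^ (i * (j + n * q)))
          = u (j + t + e) * cnj (u j) * \<omega> ^ (i' * (j + t + e)) * cnj \<omega> ^ (i * j) * ((\<omega> ^ n) ^ i' * cnj (\<omega> ^ n) ^ i) ^ q"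
          by (simp add: un power_mult_distrib power_add algebra_simps flip: power_mult)
      qed
      also have "\<dots> = 0" unfolding sum_proot_quotient_powers[OF \<omega>n] using ne by simp
      finally show ?thesis .
    qed
    thus ?thesis by (simp add: split)
  next
    case True
    hence lt: "l = k * t" using lrt by simp
    hence nkt: "\<not> n * k dvd t" using l nk by (auto simp: power2_eq_square mult_ac)
    have "(\<Sum>x<n * k ^ 2. milewski n k u (x + l) * cnj (milewski n k u x)) =
       (\<Sum>i<k. \<Sum>j<n * k. (\<omega> ^ t) ^ i * (u (j + t) * cnj (u j)))"
      unfolding split
    proof (intro sum.cong refl)
      fix i j assume "i \<in> {..<k}"
      hence i: "i < k" by simp
      have "i + k * j + l = i + k * (j + t)" by (simp add: lt algebra_simps)
      hence sl: "milewski n k u (i + k * j + l) = u (j + t) * \<omega> ^ (i * (j + t))"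
        by (simp only: sx[OF i])
      have "milewski n k u (i + k * j + l) * cnj (milewski n k u (i + k * j)) =
         u (j + t) * cnj (u j) * \<omega> ^ (i * t) * (\<omega> ^ (i * j) * cnj \<omega> ^ (i * j))"
        unfolding sl sx[OF i] by (simp add: power_add algebra_simps)
      thus "milewski n k u (i + k * j + l) * cnj (milewski n k u (i + k * j)) =
         (\<omega> ^ t) ^ i * (u (j + t) * cnj (u j))"
        by (simp add: cnj1 mult_ac flip: power_mult)
    qed
    also have "\<dots> = (\<Sum>i<k. (\<omega> ^ t) ^ i) * (\<Sum>j<n * k. u (j + t) * cnj (u j))"
      by (simp add: sum_product)
    also have "\<dots> = 0"
    proof (cases "n dvd t")
      case True
      then obtain t' where t': "t = n * t'" by blast
      have "\<not> k dvd t'" using nkt nk by (simp add: t')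
      hence "\<omega> ^ t \<noteq> 1" using \<omega>n by (simp add: t' power_mult proot_def)
      moreover have "(\<omega> ^ t) ^ k = 1"
      proof -
        have "n * k dvd t * k" by (simp add: t')
        thus ?thesis using \<omega> by (simp add: proot_def flip: power_mult)
      qed
      ultimately show ?thesis by (simp add: sum_powers_root_of_unity)
    next
      case False
      have "(\<Sum>j<n * k. u (j + t) * cnj (u j)) = (\<Sum>j<n. \<Sum>q<k. u (j + t) * cnj (u j))"
        unfolding sum_nat_blocks
      proof (intro sum.cong refl)
        fix j q
        show "u (j + n * q + t) * cnj (u (j + n * q)) = u (j + t) * cnj (u j)"
          using un[of "j + t" q] un[of j q] by (simp add: add_ac)
      qed
      also have "\<dots> = of_nat k * (\<Sum>j<n. u (j + t) * cnj (u j))" by (simp add: sum_distrib_left)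
      also have "\<dots> = 0" using orth[OF False] by simp
      finally show ?thesis by simp
    qed
    finally show ?thesis .
  qed
qed

section \<open>Seed sequences and existence\<close>

definition butson_sequence :: "nat \<Rightarrow> nat \<Rightarrow> (nat \<Rightarrow> complex) \<Rightarrow> bool" where
  "butson_sequence v h c \<longleftrightarrow> (\<forall>x. c (x + v) = c x) \<and> (\<forall>x. c x ^ h = 1) \<and>
     (\<forall>l. \<not> v dvd l \<longrightarrow> (\<Sum>x<v. c (x + l) * cnj (c x)) = 0)"

lemma butson_sequence_milewski:
  assumes "butson_sequence n h u" "n > 0" "k > 0" "n * k dvd h"
  shows "butson_sequence (n * k ^ 2) h (milewski n k u)"
proof -
  define \<omega> where "\<omega> = cis (2 * pi / real (n * k))"
  have \<omega>: "proot (n * k) \<omega>" unfolding \<omega>_def using assms by (intro proot_cis) auto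
  have "milewski n k u x ^ h = u (x div k) ^ h * (\<omega> ^ h) ^ (x mod k * (x div k))" for x
    by (simp add: milewski_def \<omega>_def power_mult_distrib mult.commute flip: power_mult)
  moreover have "\<omega> ^ h = 1" using \<omega> assms(4) by (simp add: proot_def)
  ultimately have "milewski n k u x ^ h = 1" for x
    using assms(1) by (simp add: butson_sequence_def)
  thus ?thesis using assms milewski_periodic[of n k u] milewski_orthogonal[of n k u]
    by (simp add: butson_sequence_def)
qed

text \<open>A quadratic phase sequence: shifting by \<open>l\<close> multiplies it by a constant
  times the character with exponent \<open>2 * l\<close>, which is nontrivial because
  \<open>p\<close> is odd.\<close>

lemma butson_sequence_odd_prime:
  assumes p: "prime p" "p \<noteq> 2" and h: "p dvd h"
  shows "butson_sequence p h (\<lambda>x. cis (2 * pi / real p) ^ (x ^ 2))"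
proof -
  define z where "z = cis (2 * pi / real p)"
  have p0: "p > 0" using p prime_gt_0_nat by simp
  have z: "proot p z" unfolding z_def by (rule proot_cis[OF p0])
  have "z ^ ((x + p) ^ 2) = z ^ (x ^ 2)" for x
    unfolding proot_power_eq_iff[OF z] by (rule cong_pow) (simp add: cong_def)
  moreover have "(z ^ (x ^ 2)) ^ h = 1" for x
    using z h by (simp add: proot_def flip: power_mult)
  moreover have "(\<Sum>x<p. z ^ ((x + l) ^ 2) * cnj (z ^ (x ^ 2))) = 0" if l: "\<not> p dvd l" for l
  proof -
    have "z ^ ((x + l) ^ 2) * cnj (z ^ (x ^ 2)) = z ^ (l ^ 2) * (z ^ (2 * l) * cnj z ^ 0) ^ x" for x
    proof -
      have "z ^ (x ^ 2) * cnj z ^ (x ^ 2) = 1"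
        using proot_norm[OF z] by (simp flip: power_mult_distrib complex_norm_square)
      moreover have "z ^ ((x + l) ^ 2) = z ^ (x ^ 2) * (z ^ (l ^ 2) * (z ^ (2 * l)) ^ x)"
        by (simp add: power2_sum power_add mult_ac flip: power_mult)
      ultimately show ?thesis by (simp add: mult_ac)
    qed
    hence "(\<Sum>x<p. z ^ ((x + l) ^ 2) * cnj (z ^ (x ^ 2))) =
        z ^ (l ^ 2) * (\<Sum>x<p. (z ^ (2 * l) * cnj z ^ 0) ^ x)"
      by (simp only: sum_distrib_left)
    moreover have "\<not> [2 * l = 0] (mod p)"
    proof
      assume "[2 * l = 0] (mod p)"
      hence "p dvd 2" using l p by (simp add: cong_0_iff prime_dvd_mult_iff)
      thus False using p primes_dvd_imp_eq two_is_prime_nat by blast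
    qed
    hence "(\<Sum>x<p. (z ^ (2 * l) * cnj z ^ 0) ^ x) = 0"
      unfolding sum_proot_quotient_powers[OF z] by (simp only: if_False)
    ultimately show ?thesis by (simp only: mult_zero_right)
  qed
  ultimately show ?thesis unfolding butson_sequence_def z_def[symmetric] by (intro conjI allI impI)
qed

text \<open>The two terms of the shift-1 correlation are \<open>\<i>\<close> and its
  conjugate.\<close>

lemma butson_sequence_2:
  assumes "4 dvd h"
  shows "butson_sequence 2 h (\<lambda>x. if even x then 1 else \<i>)"
proof -
  obtain k where k: "h = 4 * k" using assms by blast
  have "\<i> ^ h = 1" by (simp add: k power_mult)
  moreover have "{..<2} = {0, 1 :: nat}" by auto
  ultimately show ?thesis by (auto simp: butson_sequence_def)
qed

lemma butson_sequence_1: "butson_sequence 1 h (\<lambda>x. 1)"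
  by (simp add: butson_sequence_def)

text \<open>Even \<open>a = 2 * e\<close> starts from length 1 and odd \<open>a = 2 * e + 1\<close>
  from length \<open>p\<close>, both with \<open>k = p ^ e\<close>; the order \<open>n * k\<close>
  is then \<open>p ^ e\<close> or \<open>p ^ (e + 1)\<close>. For \<open>p = 2\<close> the odd seed
  also requires 4 to divide \<open>h\<close>, which is automatic for \<open>e > 0\<close> and
  follows from the excluded pair when \<open>e = 0\<close>.\<close>

lemma ex_butson_sequence:
  assumes p: "prime p" and h: "h > 0"
    and le: "a \<le> 2 * multiplicity p h" and ne: "(p ^ a, multiplicity 2 h) \<noteq> (2, 1)"
  shows "\<exists>c. butson_sequence (p ^ a) h c"
proof -
  define b where "b = multiplicity p h"
  have pb: "p ^ i dvd h" if "i \<le> b" for i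
    using that multiplicity_dvd' unfolding b_def by blast
  have p0: "p > 0" using p prime_gt_0_nat by simp
  show ?thesis
  proof (cases "even a")
    case True
    then obtain e where e: "a = 2 * e" by blast
    have "e \<le> b" using le by (simp add: b_def e)
    hence "butson_sequence (1 * (p ^ e) ^ 2) h (milewski 1 (p ^ e) (\<lambda>x. 1))"
      using p0 pb by (intro butson_sequence_milewski butson_sequence_1) auto
    moreover have "1 * (p ^ e) ^ 2 = p ^ a" by (simp add: e mult.commute flip: power_mult)
    ultimately show ?thesis by metis
  next
    case False
    then obtain e where e: "a = 2 * e + 1" by (elim oddE)
    have eb: "e + 1 \<le> b" using le by (simp add: b_def e)
    have "\<exists>u. butson_sequence p h u"
    proof (cases "p = 2")
      case True
      have "b \<ge> 2"
      proof (cases "e = 0")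
        case True
        thus ?thesis using ne eb \<open>p = 2\<close> by (simp add: e b_def)
      qed (use eb in simp)
      hence "4 dvd h" using pb[of 2] True by simp
      thus ?thesis using butson_sequence_2 True by blast
    next
      case False
      thus ?thesis using butson_sequence_odd_prime p pb[of 1] eb by auto
    qed
    then obtain u where u: "butson_sequence p h u" by blast
    have "butson_sequence (p * (p ^ e) ^ 2) h (milewski p (p ^ e) u)"
      using p0 pb[OF eb] by (intro butson_sequence_milewski[OF u]) auto
    moreover have "p * (p ^ e) ^ 2 = p ^ a" by (simp add: e mult.commute flip: power_mult)
    ultimately show ?thesis by metis
  qed
qed

section \<open>Circulant matrices\<close>

lemma index_mult_mat_adjoint:
  fixes H :: "complex mat"
  assumes H: "H \<in> carrier_mat v v" and ij: "i < v" "j < v"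
  shows "(H * mat_adjoint H) $$ (i, j) = (\<Sum>k<v. H $$ (i, k) * cnj (H $$ (j, k)))"
proof -
  have adj: "mat_adjoint H \<in> carrier_mat v v" using H by (auto simp: mat_adjoint_def)
  have "mat_adjoint H $$ (k, j) = cnj (H $$ (j, k))" if "k < v" for k
    using H that ij by (simp add: mat_adjoint_def mat_of_rows_index conjugate_complex_def)
  thus ?thesis using H adj ij
    by (simp add: times_mat_def scalar_prod_def atLeast0LessThan)
qed

lemma butson_sequence_cong:
  assumes "butson_sequence v h c" "[x = y] (mod v)"
  shows "c x = c y"
  by (rule periodic_cong[of c v]) (use assms in \<open>simp_all add: butson_sequence_def\<close>)

text \<open>Invariance means that the entry at \<open>(g, k)\<close> depends only on
  \<open>k - g\<close> modulo \<open>v\<close>, so row 0 determines the matrix and inner products of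
  rows are autocorrelations. On naturals the difference is written
  \<open>k + (v - g)\<close>.\<close>

lemma ex_cyclic_BH_iff:
  assumes v: "v > 0" and h: "h > 0"
  shows "(\<exists>H. cyclic_BH v h H) \<longleftrightarrow> (\<exists>c. butson_sequence v h c)"
proof
  assume "\<exists>H. cyclic_BH v h H"
  then obtain H where BH: "cyclic_BH v h H" by blast
  have carrier: "H \<in> carrier_mat v v" and HH: "H * mat_adjoint H = of_nat v \<cdot>\<^sub>m 1\<^sub>m v"
    using BH by (simp_all add: cyclic_BH_def)
  have root: "H $$ (g, k) ^ h = 1" if "g < v" "k < v" for g k
    using BH that by (simp add: cyclic_BH_def)
  have inv: "H $$ ((g + l) mod v, (k + l) mod v) = H $$ (g, k)" if "g < v" "k < v" "l < v" for g k l
    using BH that by (simp add: cyclic_BH_def cyclic_invariant_def)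
  define c where "c x = H $$ (0, x mod v)" for x
  have row: "H $$ (g, k) = c (k + (v - g))" if "g < v" "k < v" for g k
  proof -
    have "((k + (v - g)) mod v + g) mod v = (k + v) mod v"
      using that by (simp add: mod_add_left_eq)
    thus ?thesis using inv[of 0 "(k + (v - g)) mod v" g] that by (simp add: c_def)
  qed
  have "(\<Sum>x<v. c (x + l) * cnj (c x)) = 0" if l: "\<not> v dvd l" for l
  proof -
    \<comment> \<open>The row that is row 0 shifted by \<open>l\<close>, since \<open>v - g\<close>
      is \<open>l\<close> modulo \<open>v\<close>.\<close>
    define g where "g = v - l mod v"
    have "l mod v > 0" using l by (simp add: mod_greater_zero_iff_not_dvd)
    hence g: "0 < g" "g < v" "v - g = l mod v" using v by (simp_all add: g_def)
    have "c (x + l) = c (x + (v - g))" for x by (simp add: g c_def mod_add_right_eq)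
    hence "(\<Sum>x<v. c (x + l) * cnj (c x)) = (\<Sum>x<v. H $$ (g, x) * cnj (H $$ (0, x)))"
      using g v by (intro sum.cong) (simp_all add: row, simp add: c_def)
    also have "\<dots> = (H * mat_adjoint H) $$ (g, 0)" using index_mult_mat_adjoint[OF carrier] g v by simp
    also have "\<dots> = 0" using g v by (simp add: HH)
    finally show ?thesis .
  qed
  hence "butson_sequence v h c" using root v by (simp add: butson_sequence_def c_def)
  thus "\<exists>c. butson_sequence v h c" by blast
next
  assume "\<exists>c. butson_sequence v h c"
  then obtain c where c: "butson_sequence v h c" by blast
  note cong = butson_sequence_cong[OF c]
  have per: "c (x + v) = c x" and root: "c x ^ h = 1" and orth: "\<not> v dvd l \<Longrightarrow> (\<Sum>x<v. c (x + l) * cnj (c x)) = 0" for x l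
    using c by (auto simp: butson_sequence_def)
  have unit: "c x * cnj (c x) = 1" for x
    using cnj_power_root_of_unity[OF root h, of x] root[of x] h by (simp flip: power_Suc)
  define H where "H = mat v v (\<lambda>(g, k). c (k + (v - g)))"
  have H: "H \<in> carrier_mat v v" by (simp add: H_def)
  have "cyclic_invariant v H"
    unfolding cyclic_invariant_def
  proof (intro allI impI)
    fix g k l assume *: "g < v" "k < v" "l < v"
    have "[(k + l) mod v + (v - (g + l) mod v) = k + (v - g)] (mod v)"
    proof -
      have "[(k + l) mod v + (v - (g + l) mod v) + (g + l) = (k + l) + v] (mod v)"
      proof -
        have "[(k + l) mod v + (v - (g + l) mod v) + (g + l) = (k + l) + (v - (g + l) mod v) + (g + l) mod v] (mod v)"
          by (intro cong_add) (auto simp: cong_def)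
        moreover have "(g + l) mod v \<le> v" using v by (simp add: less_imp_le)
        ultimately show ?thesis by simp
      qed
      moreover have "k + l + v = k + (v - g) + (g + l)" using * by simp
      ultimately show ?thesis by (metis cong_add_rcancel_nat)
    qed
    hence "c ((k + l) mod v + (v - (g + l) mod v)) = c (k + (v - g))" by (rule cong)
    thus "H $$ ((g + l) mod v, (k + l) mod v) = H $$ (g, k)" using * v by (simp add: H_def)
  qed
  moreover have "H * mat_adjoint H = of_nat v \<cdot>\<^sub>m 1\<^sub>m v"
  proof (rule eq_matI)
    show "dim_row (H * mat_adjoint H) = dim_row (of_nat v \<cdot>\<^sub>m 1\<^sub>m v :: complex mat)"
      "dim_col (H * mat_adjoint H) = dim_col (of_nat v \<cdot>\<^sub>m 1\<^sub>m v :: complex mat)"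
      by (simp_all add: H_def mat_adjoint_def)
    fix i j assume "i < dim_row (of_nat v \<cdot>\<^sub>m 1\<^sub>m v :: complex mat)" "j < dim_col (of_nat v \<cdot>\<^sub>m 1\<^sub>m v :: complex mat)"
    hence ij: "i < v" "j < v" by simp_all
    \<comment> \<open>The difference \<open>j - i\<close> modulo \<open>v\<close>; for
      \<open>i = j\<close> it equals \<open>v\<close> rather than 0, hence the appeal to periodicity
      below.\<close>
    define l where "l = j + (v - i)"
    have "(H * mat_adjoint H) $$ (i, j) = (\<Sum>k<v. c (k + (v - i)) * cnj (c (k + (v - j))))"
      using ij by (simp add: index_mult_mat_adjoint[OF H]) (simp add: H_def)
    also have "\<dots> = (\<Sum>k<v. c (k + (v - j) + l) * cnj (c (k + (v - j))))"
    proof (intro sum.cong refl)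
      fix k
      have "k + (v - j) + l = (k + (v - i)) + v" using ij by (simp add: l_def)
      hence "c (k + (v - j) + l) = c (k + (v - i))" by (simp only: per)
      thus "c (k + (v - i)) * cnj (c (k + (v - j))) = c (k + (v - j) + l) * cnj (c (k + (v - j)))" by simp
    qed
    also have "\<dots> = (\<Sum>k<v. c (k + l) * cnj (c k))"
    proof (rule sum_periodic_shift[of "\<lambda>k. c (k + l) * cnj (c k)"])
      fix x
      have "c (x + v + l) = c (x + l)" using per[of "x + l"] by (simp add: add_ac)
      thus "c (x + v + l) * cnj (c (x + v)) = c (x + l) * cnj (c x)" by (simp add: per)
    qed
    also have "\<dots> = (if i = j then of_nat v else 0)"
    proof (cases "i = j")
      case True
      hence "l = v" using ij by (simp add: l_def)
      hence "c (k + l) = c k" for k by (simp add: per)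
      thus ?thesis using True by (simp add: unit)
    next
      case False
      have "\<not> v dvd l"
      proof
        assume "v dvd l"
        then obtain q where q: "l = v * q" by blast
        have "0 < l" "l < v * 2" using ij by (simp_all add: l_def)
        hence "q = 1" using q by auto
        thus False using q False ij by (simp add: l_def)
      qed
      thus ?thesis using False orth by simp
    qed
    finally show "(H * mat_adjoint H) $$ (i, j) = (of_nat v \<cdot>\<^sub>m 1\<^sub>m v) $$ (i, j)"
      using ij by simp
  qed
  ultimately have "cyclic_BH v h H"
    using H root by (simp add: cyclic_BH_def H_def)
  thus "\<exists>H. cyclic_BH v h H" by blast
qed

theorem theorem3p6:
  fixes p v h :: nat
  assumes "prime p"
    and "\<exists>a. v = p ^ a"
    and "h > 0"
  shows "(\<exists>H. cyclic_BH v h H) \<longleftrightarrow>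
    int (multiplicity p h) \<ge> \<lceil>real (multiplicity p v) / 2\<rceil> \<and> (v, multiplicity 2 h) \<noteq> (2, 1)"
proof -
  obtain a where va: "v = p ^ a" using assms(2) by blast
  have p0: "p > 0" using assms(1) prime_gt_0_nat by simp
  have v: "v > 0" using p0 by (simp add: va)
  have "multiplicity p v = a" using assms(1) by (simp add: va)
  hence cond: "int (multiplicity p h) \<ge> \<lceil>real (multiplicity p v) / 2\<rceil> \<longleftrightarrow> a \<le> 2 * multiplicity p h"
    by (simp add: ceiling_le_iff field_simps) linarith
  have necessary: "a \<le> 2 * multiplicity p h \<and> (v, multiplicity 2 h) \<noteq> (2, 1)"
    if c: "butson_sequence v h c" for c
  \<comment> \<open>Period 1 lies outside the locale, but both conditions hold there at
    once.\<close>
  proof (cases "a = 0")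
    case False
    have root: "c x ^ h = 1" for x using c by (simp add: butson_sequence_def)
    have unit: "cmod (c x) = 1" for x
      using root[of x] assms(3) by (metis norm_one norm_power power_eq_1_iff norm_ge_zero gr_implies_not0)
    interpret prime_power_seq p a c
      by unfold_locales (use assms(1) False c unit in \<open>auto simp: butson_sequence_def va\<close>)
    show ?thesis using exponent_condition[OF assms(3) root] unfolding va by (rule conjI)
  qed (simp add: va)
  have sufficient: "\<exists>c. butson_sequence v h c"
    if "a \<le> 2 * multiplicity p h" "(v, multiplicity 2 h) \<noteq> (2, 1)"
    using ex_butson_sequence[OF assms(1,3)] that unfolding va by simp
  show ?thesis unfolding ex_cyclic_BH_iff[OF v assms(3)] cond
    using necessary sufficient by (metis (no_types, lifting))
qed

end
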